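(* Let $p>2$ be a prime, $q$ a power of $p$, $F=\mathbb{F}_q((t))$, $F^-=\mathbb{F}_q[t^{-1}]$, $m\ge1$, and let $H=F^{2m}\times Z$ (with $Z=F$) be the Heisenberg group associated with a symplectic form $[\![\cdot,\cdot]\!]$ on $F^{2m}$ satisfying $[\![(F^-)^{2m},(F^-)^{2m}]\!]\subset F^-$. Then any arithmetic lattice in $H$ is automorphism rigid in $H$.
   Context: The group law on $H$ is $(v_1,z_1)\circ(v_2,z_2)=(v_1+v_2,\;z_1+z_2+[\![v_1,v_2]\!])$, and $H$ has the product topology from $F$. A subgroup $\Gamma$ of $H$ is arithmetic if it is commensurable with $(F^-)^{2m}\times F^-$ (the intersection has finite index in both); arithmetic subgroups are lattices, i.e. discrete and cocompact in $H$. A virtual automorphism of a topological group $G$ is an isomorphism (of topological groups) $\Lambda\colon G'\to G''$ between finite-index open subgroups $G',G''$ of $G$ (discrete groups carry the discrete topology). A discrete subgroup $\Gamma$ of $G$ is automorphism rigid in $G$ if for every virtual automorphism $\lambda\colon\Gamma_1\to\Gamma_2$ of $\Gamma$ there are a virtual automorphism $\Lambda\colon G'\to G''$ of $G$ and a finite-index subgroup $\Gamma_1'$ of $\Gamma_1$ with $\Gamma_1'\subset G'$ and $\Lambda|_{\Gamma_1'}=\lambda|_{\Gamma_1'}$. *)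

theory Defs
  imports
    "HOL-Analysis.Analysis"
    "HOL-Algebra.Coset"
    "HOL-Computational_Algebra.Formal_Laurent_Series"
begin

text \<open>\<open>H\<close> is a finite-index subgroup of the subgroup \<open>K\<close> of \<open>G\<close>.\<close>
definition finite_index_in :: "('g, 'b) monoid_scheme \<Rightarrow> 'g set \<Rightarrow> 'g set \<Rightarrow> bool" where
  "finite_index_in G H K \<longleftrightarrow>
     subgroup H (G\<lparr>carrier := K\<rparr>) \<and> finite (rcosets\<^bsub>G\<lparr>carrier := K\<rparr>\<^esub> H)"

definition commensurable :: "('g, 'b) monoid_scheme \<Rightarrow> 'g set \<Rightarrow> 'g set \<Rightarrow> bool" where
  "commensurable G A B \<longleftrightarrow> finite_index_in G (A \<inter> B) A \<and> finite_index_in G (A \<inter> B) B"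

text \<open>
  A topological group is given by a group \<open>G\<close> and a topology \<open>T\<close> on \<open>carrier G\<close>.
  Virtual automorphisms are represented by total functions; only the values on the
  domain \<open>G1\<close> are relevant.
\<close>
definition virtual_automorphism ::
    "('g, 'b) monoid_scheme \<Rightarrow> 'g topology \<Rightarrow> ('g \<Rightarrow> 'g) \<Rightarrow> 'g set \<Rightarrow> 'g set \<Rightarrow> bool" where
  "virtual_automorphism G T f G1 G2 \<longleftrightarrow>
     finite_index_in G G1 (carrier G) \<and> openin T G1 \<and>
     finite_index_in G G2 (carrier G) \<and> openin T G2 \<and>
     f \<in> iso (G\<lparr>carrier := G1\<rparr>) (G\<lparr>carrier := G2\<rparr>) \<and>
     homeomorphic_map (subtopology T G1) (subtopology T G2) f"

definition discrete_subgroup :: "('g, 'b) monoid_scheme \<Rightarrow> 'g topology \<Rightarrow> 'g set \<Rightarrow> bool" where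
  "discrete_subgroup G T \<Gamma> \<longleftrightarrow> subgroup \<Gamma> G \<and> subtopology T \<Gamma> = discrete_topology \<Gamma>"

definition automorphism_rigid :: "('g, 'b) monoid_scheme \<Rightarrow> 'g topology \<Rightarrow> 'g set \<Rightarrow> bool" where
  "automorphism_rigid G T \<Gamma> \<longleftrightarrow>
     discrete_subgroup G T \<Gamma> \<and>
     (\<forall>\<phi> \<Gamma>1 \<Gamma>2. virtual_automorphism (G\<lparr>carrier := \<Gamma>\<rparr>) (discrete_topology \<Gamma>) \<phi> \<Gamma>1 \<Gamma>2 \<longrightarrow>
        (\<exists>\<Phi> G1 G2 \<Gamma>1'. virtual_automorphism G T \<Phi> G1 G2 \<and>
            finite_index_in G \<Gamma>1' \<Gamma>1 \<and> \<Gamma>1' \<subseteq> G1 \<and> (\<forall>x\<in>\<Gamma>1'. \<Phi> x = \<phi> x)))"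

definition symplectic_form :: "('k::field ^ 'n \<Rightarrow> 'k ^ 'n \<Rightarrow> 'k) \<Rightarrow> bool" where
  "symplectic_form \<omega> \<longleftrightarrow>
     (\<forall>w. Vector_Spaces.linear (*s) (*) (\<lambda>v. \<omega> v w)) \<and>
     (\<forall>v. Vector_Spaces.linear (*s) (*) (\<lambda>w. \<omega> v w)) \<and>
     (\<forall>v. \<omega> v v = 0) \<and>
     (\<forall>v. (\<forall>w. \<omega> v w = 0) \<longrightarrow> v = 0)"

definition heisenberg :: "('k::field ^ 'n \<Rightarrow> 'k ^ 'n \<Rightarrow> 'k) \<Rightarrow> (('k ^ 'n) \<times> 'k) monoid" where
  "heisenberg \<omega> =
     \<lparr>carrier = UNIV,
      mult = (\<lambda>(v1, z1) (v2, z2). (v1 + v2, z1 + z2 + \<omega> v1 v2)),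
      one = (0, 0)\<rparr>"

text \<open>
  For \<open>F = 'a fls\<close>, the topology \<open>euclidean\<close> on \<open>(F ^ 'n) \<times> F\<close> is the product topology of
  the topology of \<open>'a fls\<close>, which is induced by the valuation metric.
\<close>
abbreviation heisenberg_topology :: "((('a::field) fls ^ 'n) \<times> 'a fls) topology" where
  "heisenberg_topology \<equiv> euclidean"

definition F_minus :: "('a::field) fls set" where
  "F_minus = range (\<lambda>P :: 'a poly. poly (map_poly fls_const P) fls_X_inv)"

definition F_minus_vec :: "(('a::field) fls ^ 'n) set" where
  "F_minus_vec = {v. \<forall>i. v $ i \<in> F_minus}"

definition arithmetic_subgroup ::
    "(('a::field) fls ^ 'n \<Rightarrow> 'a fls ^ 'n \<Rightarrow> 'a fls) \<Rightarrow> (('a fls ^ 'n) \<times> 'a fls) set \<Rightarrow> bool" where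
  "arithmetic_subgroup \<omega> \<Gamma> \<longleftrightarrow>
     subgroup \<Gamma> (heisenberg \<omega>) \<and> commensurable (heisenberg \<omega>) \<Gamma> (F_minus_vec \<times> F_minus)"

end

theory Submission
  imports Defs
begin

text \<open>
Write \<open>R = F_minus\<close> for the ring of polynomials in \<open>s = inverse t\<close>, a discrete subring of
\<open>F\<close> with fraction field \<open>k\<close>. Let \<open>\<phi>\<close> be an isomorphism between finite-index subgroups of an
arithmetic lattice. After passing to finite-index subgroups \<open>N1\<close> and \<open>N2\<close> consisting of integral
points, \<open>\<phi>\<close> maps the centre of \<open>N1\<close> to the centre of \<open>N2\<close> by an additive injection \<open>\<zeta>\<close>, and it
induces an additive bijection \<open>\<sigma>\<close> between finite-index subgroups of \<open>R\<^sup>n\<close>. Commutators give the only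
relation between the two, \<open>\<omega> (\<sigma> v) (\<sigma> w) = \<zeta> (\<omega> v w)\<close>; here the residue characteristic is odd, so
that the factor 2 of the commutator may be cancelled.

The point is that this relation forces \<open>\<sigma>\<close> to be semilinear. If \<open>f\<close> is a polynomial and \<open>v\<close> and
\<open>f v\<close> both lie in the domain of \<open>\<sigma>\<close>, then \<open>\<sigma> (f v)\<close> is orthogonal to every vector orthogonal to
\<open>\<sigma> v\<close>, hence it is a multiple of \<open>\<sigma> v\<close> (lemma \<open>line_to_line\<close>). The multiplier does not depend on
\<open>v\<close>, because \<open>\<omega> (f v) w = \<omega> v (f w)\<close>. One obtains a ring homomorphism from \<open>R\<close> to \<open>k\<close>. All its values
have a common denominator, since \<open>\<sigma>\<close> takes integral values on a subgroup of finite index, and as \<open>R\<close>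
is a principal ideal domain this makes the values integral (lemma \<open>multiplier_in\<close>). The same holds
for the inverse of \<open>\<sigma>\<close>, so the homomorphism is an automorphism of the polynomial ring: it acts on
the constants by a field automorphism and sends \<open>s\<close> to a polynomial of degree one. Therefore it
preserves the degree and extends to an isometric automorphism \<open>\<tau>\<close> of \<open>F\<close>
(lemma \<open>poly_automorphism_extends\<close>), and \<open>\<sigma>\<close> is the restriction of a \<open>\<tau>\<close>-semilinear bijection of
\<open>F\<^sup>n\<close>, for which \<open>\<omega> (\<sigma> x) (\<sigma> y) = c \<tau> (\<omega> x y)\<close> with a constant \<open>c\<close>
(theorem \<open>semilinear_extension\<close>).

What remains of \<open>\<phi>\<close> is an additive map \<open>\<eta>\<close> from a finite-index subgroup of \<open>R\<^sup>n\<close> to \<open>F\<close>, about which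
nothing more can be said. Since \<open>F\<close> has exponent \<open>p\<close>, it extends to an additive map on \<open>R\<^sup>n\<close>;
composing it with the polynomial part \<open>F\<^sup>n \<rightarrow> R\<^sup>n\<close>, which is locally constant, gives a continuous
additive map on \<open>F\<^sup>n\<close>. Likewise \<open>\<zeta>\<close> is arbitrary outside the span of the commutators, but that span
has finite index, and there \<open>\<zeta> = c \<tau>\<close>. So \<open>(v, z) \<mapsto> (\<sigma> v, c \<tau> z + \<eta> v)\<close>, with the extended maps, is
a bicontinuous automorphism of the whole group \<open>H\<close> which agrees with \<open>\<phi>\<close> on a subgroup of finite
index (theorem \<open>extension\<close>).
\<close>

section \<open>Subgroups of finite index\<close>

text \<open>
For \<open>\<delta> x y = x y\<^sup>-\<^sup>1\<close> in a group and for subgroups \<open>A\<close> and \<open>B\<close>, this says that \<open>A \<inter> B\<close> has finite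
index in \<open>B\<close>; the values of \<open>\<kappa>\<close> are labels for (at most) finitely many cosets. In this form the
additive groups and the Heisenberg group are treated alike, and intersections and preimages
are immediate.
\<close>

definition fin_quot :: "('x \<Rightarrow> 'x \<Rightarrow> 'x) \<Rightarrow> 'x set \<Rightarrow> 'x set \<Rightarrow> bool" where
  "fin_quot \<delta> A B \<longleftrightarrow>
     (\<exists>\<kappa>::'x \<Rightarrow> nat. finite (\<kappa> ` B) \<and> (\<forall>x\<in>B. \<forall>y\<in>B. \<kappa> x = \<kappa> y \<longrightarrow> \<delta> x y \<in> A))"

lemma fin_quotI:
  fixes \<kappa> :: "'x \<Rightarrow> 'c"
  assumes fin: "finite (\<kappa> ` B)"
    and sep: "\<And>x y. x \<in> B \<Longrightarrow> y \<in> B \<Longrightarrow> \<kappa> x = \<kappa> y \<Longrightarrow> \<delta> x y \<in> A"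
  shows "fin_quot \<delta> A B"
proof -
  obtain g :: "'c \<Rightarrow> nat" where g: "inj_on g (\<kappa> ` B)"
    using finite_imp_inj_to_nat_seg[OF fin] by blast
  have "\<delta> x y \<in> A" if "x \<in> B" "y \<in> B" "g (\<kappa> x) = g (\<kappa> y)" for x y
    using inj_onD[OF g that(3)] that sep by auto
  moreover have "finite ((\<lambda>x. g (\<kappa> x)) ` B)"
    using fin by (simp flip: image_image)
  ultimately show ?thesis unfolding fin_quot_def by (intro exI[of _ "\<lambda>x. g (\<kappa> x)"]) auto
qed

lemma fin_quot_preimage:
  assumes "fin_quot \<delta> A B"
    and "\<And>x. x \<in> B' \<Longrightarrow> g x \<in> B"
    and "\<And>x y. x \<in> B' \<Longrightarrow> y \<in> B' \<Longrightarrow> \<delta> (g x) (g y) \<in> A \<Longrightarrow> \<delta>' x y \<in> A'"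
  shows "fin_quot \<delta>' A' B'"
proof -
  obtain \<kappa> :: "_ \<Rightarrow> nat" where fin: "finite (\<kappa> ` B)"
    and sep: "\<And>x y. x \<in> B \<Longrightarrow> y \<in> B \<Longrightarrow> \<kappa> x = \<kappa> y \<Longrightarrow> \<delta> x y \<in> A"
    using assms(1) unfolding fin_quot_def by blast
  show ?thesis
    by (rule fin_quotI[of "\<lambda>x. \<kappa> (g x)"])
       (use assms sep in \<open>auto intro!: finite_subset[OF _ fin]\<close>)
qed

lemma fin_quot_mono: "fin_quot \<delta> A B \<Longrightarrow> B' \<subseteq> B \<Longrightarrow> A \<subseteq> A' \<Longrightarrow> fin_quot \<delta> A' B'"
  by (erule fin_quot_preimage[where g = "\<lambda>x. x"]) auto

lemma fin_quot_Int:
  assumes "fin_quot \<delta> A B" "fin_quot \<delta> A' B"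
  shows "fin_quot \<delta> (A \<inter> A') B"
proof -
  obtain \<kappa> :: "_ \<Rightarrow> nat" where fin: "finite (\<kappa> ` B)"
    and sep: "\<And>x y. x \<in> B \<Longrightarrow> y \<in> B \<Longrightarrow> \<kappa> x = \<kappa> y \<Longrightarrow> \<delta> x y \<in> A"
    using assms(1) unfolding fin_quot_def by blast
  obtain \<kappa>' :: "_ \<Rightarrow> nat" where fin': "finite (\<kappa>' ` B)"
    and sep': "\<And>x y. x \<in> B \<Longrightarrow> y \<in> B \<Longrightarrow> \<kappa>' x = \<kappa>' y \<Longrightarrow> \<delta> x y \<in> A'"
    using assms(2) unfolding fin_quot_def by blast
  show ?thesis
    by (rule fin_quotI[of "\<lambda>x. (\<kappa> x, \<kappa>' x)"])
       (use sep sep' in \<open>auto intro!: finite_subset[OF _ finite_cartesian_product[OF fin fin']]\<close>)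
qed

text \<open>
The cancellation law \<open>(x r\<^sup>-\<^sup>1) (y r\<^sup>-\<^sup>1)\<^sup>-\<^sup>1 = x y\<^sup>-\<^sup>1\<close> is all that is used of the group structure: it
allows elements of one \<open>B\<close>-coset to be compared after division by a common representative.
\<close>

lemma fin_quot_trans:
  assumes cancel: "\<And>x y r. \<delta> (\<delta> x r) (\<delta> y r) = \<delta> x y"
    and "fin_quot \<delta> A B" "fin_quot \<delta> B C"
  shows "fin_quot \<delta> A C"
proof -
  obtain \<kappa> :: "_ \<Rightarrow> nat" where fin: "finite (\<kappa> ` B)"
    and sep: "\<And>x y. x \<in> B \<Longrightarrow> y \<in> B \<Longrightarrow> \<kappa> x = \<kappa> y \<Longrightarrow> \<delta> x y \<in> A"
    using assms(2) unfolding fin_quot_def by blast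
  obtain \<kappa>' :: "_ \<Rightarrow> nat" where fin': "finite (\<kappa>' ` C)"
    and sep': "\<And>x y. x \<in> C \<Longrightarrow> y \<in> C \<Longrightarrow> \<kappa>' x = \<kappa>' y \<Longrightarrow> \<delta> x y \<in> B"
    using assms(3) unfolding fin_quot_def by blast
  define r where "r x = inv_into C \<kappa>' (\<kappa>' x)" for x
  have r: "\<delta> x (r x) \<in> B" if "x \<in> C" for x
    unfolding r_def using that by (intro sep') (auto simp: f_inv_into_f inv_into_into)
  show ?thesis
  proof (rule fin_quotI[of "\<lambda>x. (\<kappa>' x, \<kappa> (\<delta> x (r x)))"])
    show "finite ((\<lambda>x. (\<kappa>' x, \<kappa> (\<delta> x (r x)))) ` C)"
      by (rule finite_subset[OF _ finite_cartesian_product[OF fin' fin]]) (use r in auto)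
    fix x y assume xy: "x \<in> C" "y \<in> C"
      and eq: "(\<kappa>' x, \<kappa> (\<delta> x (r x))) = (\<kappa>' y, \<kappa> (\<delta> y (r y)))"
    hence "r x = r y" by (simp add: r_def)
    with sep[OF r r] xy eq show "\<delta> x y \<in> A" by (metis cancel prod.inject)
  qed
qed

lemma fin_quot_reps:
  assumes "fin_quot \<delta> A B"
  shows "\<exists>C. finite C \<and> C \<subseteq> B \<and> (\<forall>b\<in>B. \<exists>c\<in>C. \<delta> b c \<in> A)"
proof -
  obtain \<kappa> :: "_ \<Rightarrow> nat" where fin: "finite (\<kappa> ` B)"
    and sep: "\<And>x y. x \<in> B \<Longrightarrow> y \<in> B \<Longrightarrow> \<kappa> x = \<kappa> y \<Longrightarrow> \<delta> x y \<in> A"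
    using assms unfolding fin_quot_def by blast
  show ?thesis
  proof (intro exI[of _ "inv_into B \<kappa> ` (\<kappa> ` B)"] conjI ballI)
    show "finite (inv_into B \<kappa> ` (\<kappa> ` B))" using fin by simp
    show "inv_into B \<kappa> ` (\<kappa> ` B) \<subseteq> B" by (auto simp: inv_into_into)
    show "\<exists>c\<in>inv_into B \<kappa> ` (\<kappa> ` B). \<delta> b c \<in> A" if "b \<in> B" for b
      by (rule bexI[of _ "inv_into B \<kappa> (\<kappa> b)"])
         (use that in \<open>auto intro!: sep simp: f_inv_into_f inv_into_into\<close>)
  qed
qed

lemma fin_quot_infinite:
  fixes A B :: "'x::ab_group_add set"
  assumes "fin_quot (-) A B" "infinite B"
  obtains a where "a \<in> A" "a \<noteq> 0"
proof -
  obtain \<kappa> :: "_ \<Rightarrow> nat" where fin: "finite (\<kappa> ` B)"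
    and sep: "\<And>x y. x \<in> B \<Longrightarrow> y \<in> B \<Longrightarrow> \<kappa> x = \<kappa> y \<Longrightarrow> x - y \<in> A"
    using assms(1) unfolding fin_quot_def by blast
  have "\<not> inj_on \<kappa> B" using fin assms(2) finite_imageD by blast
  then obtain x y where "x \<in> B" "y \<in> B" "x \<noteq> y" "\<kappa> x = \<kappa> y" by (auto simp: inj_on_def)
  thus thesis using that[of "x - y"] sep by auto
qed

definition add_subgroup :: "'x::ab_group_add set \<Rightarrow> bool" where
  "add_subgroup U \<longleftrightarrow> 0 \<in> U \<and> (\<forall>x\<in>U. \<forall>y\<in>U. x - y \<in> U)"

lemma add_subgroupD:
  assumes "add_subgroup U"
  shows "0 \<in> U" "x \<in> U \<Longrightarrow> y \<in> U \<Longrightarrow> x - y \<in> U" "x \<in> U \<Longrightarrow> - x \<in> U"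
    "x \<in> U \<Longrightarrow> y \<in> U \<Longrightarrow> x + y \<in> U"
proof -
  have d: "x - y \<in> U" if "x \<in> U" "y \<in> U" for x y
    using assms that unfolding add_subgroup_def by blast
  show 0: "0 \<in> U" using assms unfolding add_subgroup_def by blast
  show "x - y \<in> U" if "x \<in> U" "y \<in> U" using d that .
  have n: "- x \<in> U" if "x \<in> U" for x using d[OF 0 that] by simp
  show "- x \<in> U" if "x \<in> U" using n that .
  show "x + y \<in> U" if "x \<in> U" "y \<in> U" using d[OF that(1) n[OF that(2)]] by simp
qed

section \<open>Polynomials in the inverse variable\<close>

definition emb :: "'a::field poly \<Rightarrow> 'a fls" where
  "emb P = poly (map_poly fls_const P) fls_X_inv"

lemma F_minus_emb: "F_minus = range emb"
  by (auto simp: F_minus_def emb_def)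

lemma emb_0 [simp]: "emb 0 = 0" by (simp add: emb_def)

lemma emb_pCons: "emb (pCons a P) = fls_const a + fls_X_inv * emb P"
  by (simp add: emb_def map_poly_pCons)

lemma emb_nth: "fls_nth (emb P) n = (if n \<le> 0 then coeff P (nat (- n)) else 0)"
proof (induction P arbitrary: n)
  case (pCons a P)
  show ?case
    by (auto simp: emb_pCons fls_X_inv_times_conv_shift pCons.IH coeff_pCons nat_eq_iff split: nat.split)
qed simp

lemma emb_1 [simp]: "emb 1 = 1" by (simp add: emb_pCons one_pCons)

lemma emb_add: "emb (P + Q) = emb P + emb Q"
  by (rule fls_eqI) (simp add: emb_nth)

lemma emb_diff: "emb (P - Q) = emb P - emb Q"
  by (rule fls_eqI) (simp add: emb_nth)

lemma emb_smult: "emb (smult a P) = fls_const a * emb P"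
  by (rule fls_eqI) (simp add: emb_nth)

lemma emb_mult: "emb (P * Q) = emb P * emb Q"
  by (induction P) (simp_all add: emb_pCons emb_add emb_smult algebra_simps)

lemma emb_eq_iff [simp]: "emb P = emb Q \<longleftrightarrow> P = Q"
proof
  assume eq: "emb P = emb Q"
  show "P = Q"
  proof (rule poly_eqI)
    fix n show "coeff P n = coeff Q n"
      using arg_cong[OF eq, of "\<lambda>f. fls_nth f (- int n)"] by (simp add: emb_nth)
  qed
qed simp

lemma emb_eq_0_iff [simp]: "emb P = 0 \<longleftrightarrow> P = 0"
  using emb_eq_iff[of P 0] by simp

text \<open>
The projection of \<open>F\<close> onto \<open>F_minus\<close> along the maximal ideal of the power series; the principal
part \<open>fls_prpart\<close> alone lacks the constant term.
\<close>

definition poly_part :: "'a::field fls \<Rightarrow> 'a fls" where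
  "poly_part f = emb (fls_prpart f + [:fls_nth f 0:])"

lemma poly_part_nth: "fls_nth (poly_part f) n = (if n \<le> 0 then fls_nth f n else 0)"
  by (auto simp: poly_part_def emb_nth coeff_pCons split: nat.split)

lemma poly_part_in [simp]: "poly_part f \<in> F_minus"
  by (auto simp: F_minus_emb poly_part_def)

lemma F_minus_iff: "f \<in> F_minus \<longleftrightarrow> (\<forall>n>0. fls_nth f n = 0)"
proof
  assume "\<forall>n>0. fls_nth f n = 0"
  hence "f = poly_part f" by (intro fls_eqI) (simp add: poly_part_nth)
  thus "f \<in> F_minus" by (metis poly_part_in)
qed (auto simp: F_minus_emb emb_nth)

lemma poly_part_id: "f \<in> F_minus \<Longrightarrow> poly_part f = f"
  by (intro fls_eqI) (simp add: poly_part_nth F_minus_iff)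

lemma poly_part_add: "poly_part (f + g) = poly_part f + poly_part g"
  by (intro fls_eqI) (simp add: poly_part_nth)

lemma emb_in [simp]: "emb P \<in> F_minus" by (auto simp: F_minus_emb)

lemma add_subgroup_F_minus: "add_subgroup F_minus"
  by (auto simp: add_subgroup_def F_minus_iff)

lemma F_minus_mult: "f \<in> F_minus \<Longrightarrow> g \<in> F_minus \<Longrightarrow> f * g \<in> F_minus"
  by (auto simp: F_minus_emb simp flip: emb_mult)

lemma add_subgroup_F_minus_vec: "add_subgroup F_minus_vec"
  using add_subgroup_F_minus by (auto simp: add_subgroup_def F_minus_vec_def)

lemma F_minus_vec_scale: "f \<in> F_minus \<Longrightarrow> v \<in> F_minus_vec \<Longrightarrow> f *s v \<in> F_minus_vec"
  by (auto simp: F_minus_vec_def F_minus_mult)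

section \<open>Integral symplectic forms\<close>

lemma infinite_UNIV_poly: "infinite (UNIV :: 'a::comm_semiring_1 poly set)"
proof -
  have "inj (\<lambda>n. monom (1::'a) n)" by (auto simp: inj_def monom_eq_iff')
  thus ?thesis by (rule range_inj_infinite[THEN infinite_super[rotated]]) simp
qed

text \<open>
A substitute for clearing denominators: although \<open>U\<close> is only an additive group, the polynomials
that multiply a given integral vector into \<open>U\<close> form a group of finite index in the infinite group
of all polynomials, and finitely many such groups still have a nonzero common element.
\<close>

lemma common_multiplier:
  fixes U :: "('a::field fls ^ 'n) set"
  assumes U: "fin_quot (-) U F_minus_vec" and S: "finite S" "S \<subseteq> F_minus_vec"
  shows "\<exists>d. d \<noteq> 0 \<and> (\<forall>w\<in>S. emb d *s w \<in> U)"
proof -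
  have one: "fin_quot (-) {d. emb d *s w \<in> U} UNIV" if "w \<in> F_minus_vec" for w
  proof (rule fin_quot_preimage[OF U, where g = "\<lambda>d. emb d *s w"])
    show "emb d *s w \<in> F_minus_vec" for d by (intro F_minus_vec_scale emb_in that)
    show "d - d' \<in> {d. emb d *s w \<in> U}" if "emb d *s w - emb d' *s w \<in> U" for d d'
      using that by (simp add: emb_diff)
  qed
  have "fin_quot (-) {d. \<forall>w\<in>S. emb d *s w \<in> U} UNIV"
    using S
  proof (induction rule: finite_induct)
    case empty
    show ?case by (rule fin_quotI[of "\<lambda>_. ()"]) auto
  next
    case (insert w S)
    have "fin_quot (-) ({d. \<forall>w\<in>S. emb d *s w \<in> U} \<inter> {d. emb d *s w \<in> U}) UNIV"
      using insert by (intro fin_quot_Int one) auto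
    thus ?case by (rule fin_quot_mono) auto
  qed
  then obtain d where "d \<in> {d. \<forall>w\<in>S. emb d *s w \<in> U}" "d \<noteq> 0"
    by (rule fin_quot_infinite[OF _ infinite_UNIV_poly])
  thus ?thesis by auto
qed

locale integral_symplectic =
  fixes \<omega> :: "'a::field fls ^ 'n \<Rightarrow> 'a fls ^ 'n \<Rightarrow> 'a fls"
  assumes symp: "symplectic_form \<omega>"
    and integral: "v \<in> F_minus_vec \<Longrightarrow> w \<in> F_minus_vec \<Longrightarrow> \<omega> v w \<in> F_minus"
begin

lemma
  shows add_left: "\<omega> (u + v) w = \<omega> u w + \<omega> v w"
    and add_right: "\<omega> w (u + v) = \<omega> w u + \<omega> w v"
    and scale_left: "\<omega> (c *s v) w = c * \<omega> v w"
    and scale_right: "\<omega> v (c *s w) = c * \<omega> v w"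
    and alt [simp]: "\<omega> v v = 0"
    and nondegenerate: "(\<And>w. \<omega> v w = 0) \<Longrightarrow> v = 0"
proof -
  have l: "Vector_Spaces.linear (*s) (*) (\<lambda>v. \<omega> v w)" and r: "Vector_Spaces.linear (*s) (*) (\<lambda>w. \<omega> v w)"
    for v w using symp unfolding symplectic_form_def by blast+
  show "\<omega> (u + v) w = \<omega> u w + \<omega> v w" "\<omega> (c *s v) w = c * \<omega> v w"
    using l[of w] unfolding Vector_Spaces.linear_iff by simp_all
  show "\<omega> w (u + v) = \<omega> w u + \<omega> w v" "\<omega> v (c *s w) = c * \<omega> v w"
    using r unfolding Vector_Spaces.linear_iff by simp_all
  show "\<omega> v v = 0" "(\<And>w. \<omega> v w = 0) \<Longrightarrow> v = 0"
    using symp unfolding symplectic_form_def by blast+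
qed

lemma zero_left [simp]: "\<omega> 0 w = 0" and zero_right [simp]: "\<omega> w 0 = 0"
  using scale_left[of 0 0 w] scale_right[of w 0 0] by simp_all

lemma minus_left: "\<omega> (- v) w = - \<omega> v w" and minus_right: "\<omega> v (- w) = - \<omega> v w"
  using scale_left[of "-1" v w] scale_right[of v "-1" w] by simp_all

lemma diff_left: "\<omega> (u - v) w = \<omega> u w - \<omega> v w"
  and diff_right: "\<omega> w (u - v) = \<omega> w u - \<omega> w v"
  using add_left[of u "- v" w] add_right[of w u "- v"] by (simp_all add: minus_left minus_right)

lemma antisym: "\<omega> w v = - \<omega> v w"
proof -
  have "\<omega> (v + w) (v + w) = \<omega> v w + \<omega> w v"
    unfolding add_left add_right by simp
  thus ?thesis by (simp add: eq_neg_iff_add_eq_0 add.commute)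
qed

lemma sum_right: "\<omega> v (sum f S) = (\<Sum>i\<in>S. \<omega> v (f i))"
  by (induction S rule: infinite_finite_induct) (simp_all add: add_right)

lemma sum_left: "\<omega> (sum f S) v = (\<Sum>i\<in>S. \<omega> (f i) v)"
  by (induction S rule: infinite_finite_induct) (simp_all add: add_left)

lemma axis_in: "axis i 1 \<in> F_minus_vec"
proof -
  have "0 \<in> F_minus" "1 \<in> F_minus" using emb_in[of 0] emb_in[of 1] by simp_all
  thus ?thesis by (auto simp: F_minus_vec_def axis_def)
qed

lemma exists_nonorthogonal:
  assumes U: "fin_quot (-) U F_minus_vec" and v: "v \<noteq> 0"
  obtains w where "w \<in> U" "\<omega> v w \<noteq> 0"
proof -
  have "\<exists>w\<in>U. \<omega> v w \<noteq> 0"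
  proof (rule ccontr)
    assume neg: "\<not> ?thesis"
    have ax: "\<omega> v (axis i 1) = 0" for i
    proof -
      obtain d where d: "d \<noteq> 0" "emb d *s axis i 1 \<in> U"
        using common_multiplier[OF U, of "{axis i 1}"] axis_in by auto
      hence "\<omega> v (emb d *s axis i 1) = 0" using neg by blast
      thus ?thesis using d by (simp add: scale_right)
    qed
    have "\<omega> v w = 0" for w
      by (subst basis_expansion[of w, symmetric]) (simp add: sum_right scale_right ax)
    thus False using v nondegenerate by blast
  qed
  thus thesis using that by blast
qed

lemma fin_quot_self: "fin_quot (-) F_minus_vec F_minus_vec"
  by (rule fin_quotI[of "\<lambda>_. ()"]) (auto intro: add_subgroupD[OF add_subgroup_F_minus_vec])

text \<open>
The orthogonal complements of two nonzero vectors do not cover the integral vectors: a group is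
not the union of two proper subgroups.
\<close>

lemma exists_nonorthogonal2:
  assumes "v \<noteq> 0" "v' \<noteq> 0"
  obtains w where "w \<in> F_minus_vec" "\<omega> v w \<noteq> 0" "\<omega> v' w \<noteq> 0"
proof -
  obtain w where w: "w \<in> F_minus_vec" "\<omega> v w \<noteq> 0"
    using exists_nonorthogonal[OF fin_quot_self assms(1)] .
  obtain w' where w': "w' \<in> F_minus_vec" "\<omega> v' w' \<noteq> 0"
    using exists_nonorthogonal[OF fin_quot_self assms(2)] .
  have "w + w' \<in> F_minus_vec" using w w' add_subgroupD[OF add_subgroup_F_minus_vec] by blast
  thus thesis
    using that[of w] that[of w'] that[of "w + w'"] w w'
    by (cases "\<omega> v' w = 0"; cases "\<omega> v w' = 0") (simp_all add: add_right)
qed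

end

section \<open>Multipliers of a symplectic correspondence\<close>

text \<open>
The map that an isomorphism of Heisenberg lattices induces modulo the centres. The last
condition is the existence of an injective \<open>\<zeta>\<close> with \<open>\<omega> (\<sigma> x) (\<sigma> y) = \<zeta> (\<omega> x y)\<close>, stated without
\<open>\<zeta>\<close>; in this form the hypotheses are invariant under passing to the inverse of \<open>\<sigma>\<close>.
\<close>

locale symplectic_correspondence = integral_symplectic \<omega>
  for \<omega> :: "'a::field fls ^ 'n \<Rightarrow> 'a fls ^ 'n \<Rightarrow> 'a fls" +
  fixes U W :: "('a fls ^ 'n) set" and \<sigma> :: "'a fls ^ 'n \<Rightarrow> 'a fls ^ 'n"
  assumes U: "add_subgroup U" "U \<subseteq> F_minus_vec" "fin_quot (-) U F_minus_vec"
    and W: "add_subgroup W" "W \<subseteq> F_minus_vec" "fin_quot (-) W F_minus_vec"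
    and bij: "bij_betw \<sigma> U W"
    and additive: "x \<in> U \<Longrightarrow> y \<in> U \<Longrightarrow> \<sigma> (x + y) = \<sigma> x + \<sigma> y"
    and pairing: "\<lbrakk>x \<in> U; y \<in> U; x' \<in> U; y' \<in> U\<rbrakk> \<Longrightarrow>
        \<omega> x y = \<omega> x' y' \<longleftrightarrow> \<omega> (\<sigma> x) (\<sigma> y) = \<omega> (\<sigma> x') (\<sigma> y')"
begin

lemma sigma_in: "x \<in> U \<Longrightarrow> \<sigma> x \<in> W"
  using bij by (auto simp: bij_betw_def)

lemma sigma_0: "\<sigma> 0 = 0"
  using additive[of 0 0] add_subgroupD(1)[OF U(1)] by simp

lemma sigma_eq_0: "x \<in> U \<Longrightarrow> \<sigma> x = 0 \<longleftrightarrow> x = 0"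
  using bij sigma_0 add_subgroupD(1)[OF U(1)] unfolding bij_betw_def inj_on_def by metis

lemma pairing_0: "x \<in> U \<Longrightarrow> y \<in> U \<Longrightarrow> \<omega> x y = 0 \<longleftrightarrow> \<omega> (\<sigma> x) (\<sigma> y) = 0"
  using pairing[of x y 0 0] add_subgroupD(1)[OF U(1)] by (simp add: sigma_0)

text \<open>
This is the step from additivity to semilinearity. A vector of \<open>W\<close> orthogonal to \<open>\<sigma> v\<close> comes from
one orthogonal to \<open>v\<close>, hence to \<open>f v\<close>, so it is orthogonal to \<open>\<sigma> (f v)\<close>. There are enough such
vectors, because \<open>\<omega>\<close> is integral: projecting any \<open>u\<close> to the complement of \<open>\<sigma> v\<close> along \<open>\<sigma> y\<close> and
multiplying by \<open>\<omega> (\<sigma> v) (\<sigma> y)\<close> gives an integral vector, and \<open>common_multiplier\<close> moves it into \<open>W\<close>.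
\<close>

lemma line_to_line:
  assumes v: "v \<in> U" "f *s v \<in> U" and y: "y \<in> U"
  shows "\<omega> (\<sigma> v) (\<sigma> y) *s \<sigma> (f *s v) = \<omega> (\<sigma> (f *s v)) (\<sigma> y) *s \<sigma> v"
proof -
  let ?a = "\<omega> (\<sigma> v) (\<sigma> y)" and ?b = "\<omega> (\<sigma> (f *s v)) (\<sigma> y)"
  let ?x = "?a *s \<sigma> (f *s v) - ?b *s \<sigma> v"
  have orth: "\<omega> ?x u = 0" if u: "u \<in> W" for u
  proof -
    let ?w = "?a *s u - \<omega> (\<sigma> v) u *s \<sigma> y"
    have in_R: "\<sigma> v \<in> F_minus_vec" "\<sigma> y \<in> F_minus_vec" "u \<in> F_minus_vec"
      using u v y sigma_in W(2) by auto
    hence "?w \<in> F_minus_vec"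
      by (intro add_subgroupD(2)[OF add_subgroup_F_minus_vec] F_minus_vec_scale integral)
    then obtain d where d: "d \<noteq> 0" "emb d *s ?w \<in> W"
      using common_multiplier[OF W(3), of "{?w}"] by auto
    then obtain w where w: "w \<in> U" "\<sigma> w = emb d *s ?w"
      using bij unfolding bij_betw_def by (metis imageE)
    have "\<omega> (\<sigma> v) (\<sigma> w) = 0"
      unfolding w by (simp add: scale_right diff_right)
    hence "\<omega> v w = 0" using pairing_0 v w by simp
    hence "\<omega> (f *s v) w = 0" by (simp add: scale_left)
    hence "\<omega> (\<sigma> (f *s v)) (\<sigma> w) = 0" using pairing_0 v w by simp
    hence "emb d * \<omega> (\<sigma> (f *s v)) ?w = 0" unfolding w scale_right .
    hence "\<omega> (\<sigma> (f *s v)) ?w = 0" using d by simp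
    thus ?thesis by (simp add: scale_right scale_left diff_right diff_left algebra_simps)
  qed
  have "?x = 0"
  proof (rule ccontr)
    assume "?x \<noteq> 0"
    then obtain u where "u \<in> W" "\<omega> ?x u \<noteq> 0" by (rule exists_nonorthogonal[OF W(3)])
    thus False using orth by blast
  qed
  thus ?thesis by simp
qed

lemma local_multiplier:
  assumes "v \<in> U" "v \<noteq> 0" "f *s v \<in> U"
  obtains l where "\<sigma> (f *s v) = l *s \<sigma> v"
proof -
  have "\<sigma> v \<noteq> 0" using assms sigma_eq_0 by simp
  then obtain u where u: "u \<in> W" "\<omega> (\<sigma> v) u \<noteq> 0" by (rule exists_nonorthogonal[OF W(3)])
  then obtain y where y: "y \<in> U" "\<sigma> y = u"
    using bij unfolding bij_betw_def by (metis imageE)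
  let ?a = "\<omega> (\<sigma> v) (\<sigma> y)"
  have a: "?a \<noteq> 0" using u y by simp
  have "\<sigma> (f *s v) = inverse ?a *s (?a *s \<sigma> (f *s v))" using a by (simp add: vector_smult_assoc)
  also have "\<dots> = (inverse ?a * \<omega> (\<sigma> (f *s v)) (\<sigma> y)) *s \<sigma> v"
    using line_to_line[OF assms(1,3) y(1)] by (simp add: vector_smult_assoc)
  finally show thesis by (rule that)
qed

text \<open>
Multiplication by \<open>f\<close> is self-adjoint, and \<open>\<sigma>\<close> respects equalities between values of \<open>\<omega>\<close>.
\<close>

lemma local_multiplier_eq:
  assumes "v \<in> U" "f *s v \<in> U" "\<sigma> (f *s v) = l *s \<sigma> v"
    and "w \<in> U" "f *s w \<in> U" "\<sigma> (f *s w) = l' *s \<sigma> w"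
    and "\<omega> v w \<noteq> 0"
  shows "l = l'"
proof -
  have "\<omega> (f *s v) w = \<omega> v (f *s w)" by (simp add: scale_left scale_right)
  hence "\<omega> (\<sigma> (f *s v)) (\<sigma> w) = \<omega> (\<sigma> v) (\<sigma> (f *s w))" using pairing assms by blast
  hence "l * \<omega> (\<sigma> v) (\<sigma> w) = l' * \<omega> (\<sigma> v) (\<sigma> w)"
    using assms by (simp add: scale_left scale_right)
  thus ?thesis using pairing_0 assms by simp
qed

lemma exists_multiplicand:
  assumes "finite S"
  shows "\<exists>v. v \<in> U \<and> v \<noteq> 0 \<and> (\<forall>P\<in>S. emb P *s v \<in> U)"
proof -
  fix i :: 'n
  let ?e = "axis i 1 :: 'a fls ^ 'n"
  have "(\<lambda>P. emb P *s ?e) ` insert 1 S \<subseteq> F_minus_vec"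
    by (auto intro!: F_minus_vec_scale axis_in)
  then obtain d where d: "d \<noteq> 0" "\<forall>w\<in>(\<lambda>P. emb P *s ?e) ` insert 1 S. emb d *s w \<in> U"
    using common_multiplier[OF U(3), of "(\<lambda>P. emb P *s ?e) ` insert 1 S"] assms by blast
  show ?thesis
  proof (intro exI[of _ "emb d *s ?e"] conjI ballI)
    show "emb d *s ?e \<in> U" using d(2) by simp
    have "(emb d *s ?e) $ i \<noteq> 0" using d(1) by simp
    thus "emb d *s ?e \<noteq> 0" by (metis zero_index)
    show "emb P *s (emb d *s ?e) \<in> U" if "P \<in> S" for P
      using d(2) that by (simp add: mult.commute)
  qed
qed

definition multiplier :: "'a poly \<Rightarrow> 'a fls" where
  "multiplier P = (SOME l. \<forall>v\<in>U. emb P *s v \<in> U \<longrightarrow> \<sigma> (emb P *s v) = l *s \<sigma> v)"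

text \<open>
Any two vectors have multipliers equal to that of a third one which is orthogonal to neither.
\<close>

lemma multiplier:
  assumes "v \<in> U" "emb P *s v \<in> U"
  shows "\<sigma> (emb P *s v) = multiplier P *s \<sigma> v"
proof -
  obtain v0 where v0: "v0 \<in> U" "v0 \<noteq> 0" "emb P *s v0 \<in> U"
    using exists_multiplicand[of "{P}"] by auto
  obtain l where l: "\<sigma> (emb P *s v0) = l *s \<sigma> v0" by (rule local_multiplier[OF v0])
  have "\<sigma> (emb P *s v) = l *s \<sigma> v" if v: "v \<in> U" "emb P *s v \<in> U" for v
  proof (cases "v = 0")
    case False
    obtain l' where l': "\<sigma> (emb P *s v) = l' *s \<sigma> v" by (rule local_multiplier[OF v(1) False v(2)])
    obtain w where w: "w \<in> F_minus_vec" "\<omega> v0 w \<noteq> 0" "\<omega> v w \<noteq> 0"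
      by (rule exists_nonorthogonal2[OF v0(2) False])
    obtain d where d: "d \<noteq> 0" "emb d *s w \<in> U" "emb d *s (emb P *s w) \<in> U"
      using common_multiplier[OF U(3), of "{w, emb P *s w}"] w by (auto simp: F_minus_vec_scale)
    let ?w = "emb d *s w"
    have w': "?w \<in> U" "emb P *s ?w \<in> U" "\<omega> v0 ?w \<noteq> 0" "\<omega> v ?w \<noteq> 0"
      using d w by (simp_all add: vector_smult_assoc mult.commute scale_right)
    hence w0: "?w \<noteq> 0" using zero_right by metis
    obtain l'' where l'': "\<sigma> (emb P *s ?w) = l'' *s \<sigma> ?w" by (rule local_multiplier[OF w'(1) w0 w'(2)])
    have "l = l''" using local_multiplier_eq[OF v0(1,3) l w'(1,2) l'' w'(3)] .
    moreover have "l' = l''" using local_multiplier_eq[OF v l' w'(1,2) l'' w'(4)] .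
    ultimately show ?thesis using l' by simp
  qed (simp add: sigma_0)
  hence "\<forall>v\<in>U. emb P *s v \<in> U \<longrightarrow> \<sigma> (emb P *s v) = l *s \<sigma> v" by simp
  hence "\<forall>v\<in>U. emb P *s v \<in> U \<longrightarrow> \<sigma> (emb P *s v) = multiplier P *s \<sigma> v"
    unfolding multiplier_def by (rule someI)
  thus ?thesis using assms by simp
qed

lemma multiplier_unique:
  assumes "v \<in> U" "v \<noteq> 0" "emb P *s v \<in> U" "\<sigma> (emb P *s v) = l *s \<sigma> v"
  shows "multiplier P = l"
proof -
  have "\<sigma> v \<noteq> 0" using assms sigma_eq_0 by simp
  thus ?thesis using multiplier[OF assms(1,3)] assms(4) by simp
qed

lemma multiplier_1: "multiplier 1 = 1"
proof -
  obtain v where "v \<in> U" "v \<noteq> 0" using exists_multiplicand[of "{}"] by auto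
  thus ?thesis by (intro multiplier_unique[of v]) simp_all
qed

lemma multiplier_add: "multiplier (P + Q) = multiplier P + multiplier Q"
proof -
  obtain v where v: "v \<in> U" "v \<noteq> 0" "emb P *s v \<in> U" "emb Q *s v \<in> U" "emb (P + Q) *s v \<in> U"
    using exists_multiplicand[of "{P, Q, P + Q}"] by auto
  have "\<sigma> (emb (P + Q) *s v) = \<sigma> (emb P *s v) + \<sigma> (emb Q *s v)"
    using additive[OF v(3,4)] by (simp add: emb_add)
  hence "\<sigma> (emb (P + Q) *s v) = (multiplier P + multiplier Q) *s \<sigma> v"
    using multiplier v by simp
  thus ?thesis using v by (intro multiplier_unique[of v])
qed

lemma multiplier_mult: "multiplier (P * Q) = multiplier P * multiplier Q"
proof -
  obtain v where v: "v \<in> U" "v \<noteq> 0" "emb Q *s v \<in> U" "emb (P * Q) *s v \<in> U"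
    using exists_multiplicand[of "{Q, P * Q}"] by auto
  have "\<sigma> (emb (P * Q) *s v) = multiplier P *s \<sigma> (emb Q *s v)"
  proof -
    have "emb (P * Q) *s v = emb P *s (emb Q *s v)" by (simp add: emb_mult)
    thus ?thesis using multiplier[of "emb Q *s v" P] v by simp
  qed
  hence "\<sigma> (emb (P * Q) *s v) = (multiplier P * multiplier Q) *s \<sigma> v"
    using multiplier[OF v(1,3)] by simp
  thus ?thesis using v by (intro multiplier_unique[of v])
qed

lemma multiplier_denominator:
  obtains d where "d \<noteq> 0" "emb d * multiplier P \<in> F_minus"
proof -
  obtain v where v: "v \<in> U" "v \<noteq> 0" "emb P *s v \<in> U"
    using exists_multiplicand[of "{P}"] by auto
  have "\<sigma> v \<noteq> 0" using v sigma_eq_0 by simp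
  then obtain i where i: "\<sigma> v $ i \<noteq> 0" by (auto simp: vec_eq_iff)
  have "\<sigma> v \<in> F_minus_vec" "\<sigma> (emb P *s v) \<in> F_minus_vec" using v sigma_in W(2) by auto
  hence *: "\<sigma> v $ i \<in> F_minus" "(multiplier P *s \<sigma> v) $ i \<in> F_minus"
    using multiplier v by (auto simp: F_minus_vec_def)
  then obtain d where "\<sigma> v $ i = emb d" by (auto simp: F_minus_emb)
  thus thesis using that[of d] * i by (auto simp: mult.commute)
qed

text \<open>
Fix \<open>v \<noteq> 0\<close> in \<open>U\<close>. The polynomials \<open>P\<close> with \<open>P v\<close> in \<open>U\<close> have finite index, and on these a nonzero
coordinate of \<open>\<sigma> v\<close> is a denominator; the finitely many remaining cosets contribute one
denominator each.
\<close>

lemma uniform_denominator: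
  obtains D where "D \<noteq> 0" "\<And>P. emb D * multiplier P \<in> F_minus"
proof -
  obtain v where v: "v \<in> U" "v \<noteq> 0" using exists_multiplicand[of "{}"] by auto
  hence "\<sigma> v \<noteq> 0" using sigma_eq_0 by simp
  then obtain i where i: "\<sigma> v $ i \<noteq> 0" by (auto simp: vec_eq_iff)
  have "\<sigma> v \<in> F_minus_vec" using v sigma_in W(2) by blast
  hence "\<sigma> v $ i \<in> F_minus" by (simp add: F_minus_vec_def)
  then obtain e where e: "\<sigma> v $ i = emb e" by (auto simp: F_minus_emb)
  let ?A = "{P. emb P *s v \<in> U}"
  have "fin_quot (-) ?A UNIV"
  proof (rule fin_quot_preimage[OF U(3), where g = "\<lambda>d. emb d *s v"])
    show "emb d *s v \<in> F_minus_vec" for d using v U(2) by (intro F_minus_vec_scale) auto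
    show "d - d' \<in> ?A" if "emb d *s v - emb d' *s v \<in> U" for d d'
      using that by (simp add: emb_diff)
  qed
  from fin_quot_reps[OF this] obtain C where C: "finite C" "\<And>P. \<exists>c\<in>C. P - c \<in> ?A"
    by auto
  have "\<forall>c. \<exists>d. d \<noteq> 0 \<and> emb d * multiplier c \<in> F_minus"
  proof
    show "\<exists>d. d \<noteq> 0 \<and> emb d * multiplier c \<in> F_minus" for c
      by (rule multiplier_denominator[of c]) blast
  qed
  from choice[OF this] obtain d
    where d: "\<And>c. d c \<noteq> 0" "\<And>c. emb (d c) * multiplier c \<in> F_minus" by blast
  have A: "emb e * multiplier P \<in> F_minus" if "P \<in> ?A" for P
  proof -
    have "\<sigma> (emb P *s v) \<in> F_minus_vec" using that sigma_in W(2) by blast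
    hence "\<sigma> (emb P *s v) $ i \<in> F_minus" by (simp add: F_minus_vec_def)
    thus ?thesis using multiplier[of v P] v that e by (simp add: mult.commute)
  qed
  let ?D = "e * (\<Prod>c\<in>C. d c)"
  show thesis
  proof
    show "?D \<noteq> 0" using C(1) d(1) e i by auto
    fix P
    obtain c where c: "c \<in> C" "P - c \<in> ?A" using C(2) by blast
    have "?D = d c * (e * (\<Prod>c\<in>C - {c}. d c))"
      using c C(1) by (simp add: prod.remove mult_ac)
    hence eq1: "emb ?D * multiplier c = emb (e * (\<Prod>c\<in>C - {c}. d c)) * (emb (d c) * multiplier c)"
      by (simp only: emb_mult mult_ac)
    have 1: "emb ?D * multiplier c \<in> F_minus"
      unfolding eq1 by (rule F_minus_mult[OF emb_in d(2)])
    have eq2: "emb ?D * multiplier (P - c) = emb (\<Prod>c\<in>C. d c) * (emb e * multiplier (P - c))"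
      by (simp only: emb_mult mult_ac)
    have 2: "emb ?D * multiplier (P - c) \<in> F_minus"
      unfolding eq2 by (rule F_minus_mult[OF emb_in A[OF c(2)]])
    have "multiplier P = multiplier c + multiplier (P - c)" by (simp flip: multiplier_add)
    thus "emb ?D * multiplier P \<in> F_minus"
      using add_subgroupD(4)[OF add_subgroup_F_minus 1 2] by (simp add: distrib_left)
  qed
qed

text \<open>
The common denominators form an ideal of the polynomial ring which is stable under multiplication
by the multipliers. Let \<open>D\<close> be a nonzero element of least degree. The remainder of
\<open>D * multiplier P\<close> modulo \<open>D\<close> is again a common denominator, so it vanishes, and the quotient is
\<open>multiplier P\<close>.
\<close>

lemma multiplier_in: "multiplier P \<in> F_minus"
proof -
  define J where "J = {D. \<forall>Q. emb D * multiplier Q \<in> F_minus}"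
  obtain D0 where "D0 \<noteq> 0" "D0 \<in> J" using uniform_denominator by (auto simp: J_def)
  define D where "D = arg_min degree (\<lambda>D. D \<in> J \<and> D \<noteq> 0)"
  have D: "D \<in> J" "D \<noteq> 0" and min: "\<And>E. E \<in> J \<Longrightarrow> E \<noteq> 0 \<Longrightarrow> degree D \<le> degree E"
    using arg_min_nat_lemma[of "\<lambda>D. D \<in> J \<and> D \<noteq> 0" D0 degree] \<open>D0 \<noteq> 0\<close> \<open>D0 \<in> J\<close>
    unfolding D_def by auto
  have "emb D * multiplier P \<in> F_minus" using D by (simp add: J_def)
  then obtain E where E: "emb D * multiplier P = emb E" by (auto simp: F_minus_emb)
  let ?r = "E mod D"
  have r: "emb ?r = emb D * multiplier P - emb (E div D) * emb D"
    unfolding E by (simp flip: emb_mult emb_diff add: minus_div_mult_eq_mod)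
  have "?r \<in> J" unfolding J_def
  proof safe
    fix Q
    have "emb ?r * multiplier Q = emb D * multiplier (P * Q) - emb (E div D) * (emb D * multiplier Q)"
      unfolding r by (simp add: multiplier_mult algebra_simps)
    moreover have "emb D * multiplier (P * Q) \<in> F_minus" "emb D * multiplier Q \<in> F_minus"
      using D by (simp_all add: J_def)
    ultimately show "emb ?r * multiplier Q \<in> F_minus"
      by (simp add: add_subgroupD(2)[OF add_subgroup_F_minus] F_minus_mult)
  qed
  hence "?r = 0" using min[of ?r] degree_mod_less[OF D(2), of E] by linarith
  hence "emb D * multiplier P = emb D * emb (E div D)" using r by (simp add: mult.commute)
  thus ?thesis using D by simp
qed

text \<open>
The multiplier as a polynomial: an endomorphism, and in fact an automorphism, of the ring of
polynomials with respect to which \<open>\<sigma>\<close> is semilinear.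
\<close>

definition twist :: "'a poly \<Rightarrow> 'a poly" where
  "twist P = (THE Q. multiplier P = emb Q)"

lemma emb_twist: "emb (twist P) = multiplier P"
proof -
  have "\<exists>!Q. multiplier P = emb Q" using multiplier_in[of P] by (auto simp: F_minus_emb)
  from theI'[OF this] show ?thesis by (simp add: twist_def)
qed

lemma twist_add: "twist (P + Q) = twist P + twist Q"
  by (simp add: emb_twist multiplier_add emb_add flip: emb_eq_iff)

lemma twist_mult: "twist (P * Q) = twist P * twist Q"
  by (simp add: emb_twist multiplier_mult emb_mult flip: emb_eq_iff)

lemma twist_1: "twist 1 = 1"
  using emb_twist[of 1] multiplier_1 by (metis emb_1 emb_eq_iff)

lemma semilinear: "v \<in> U \<Longrightarrow> emb P *s v \<in> U \<Longrightarrow> \<sigma> (emb P *s v) = emb (twist P) *s \<sigma> v"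
  by (simp add: emb_twist multiplier)

lemma inverse_correspondence: "symplectic_correspondence \<omega> W U (inv_into U \<sigma>)"
proof
  have inv: "inv_into U \<sigma> x \<in> U" "\<sigma> (inv_into U \<sigma> x) = x" if "x \<in> W" for x
    using bij that by (auto simp: bij_betw_def inv_into_into f_inv_into_f)
  show "bij_betw (inv_into U \<sigma>) W U" by (rule bij_betw_inv_into[OF bij])
  show "inv_into U \<sigma> (x + y) = inv_into U \<sigma> x + inv_into U \<sigma> y" if "x \<in> W" "y \<in> W" for x y
    using additive[of "inv_into U \<sigma> x" "inv_into U \<sigma> y"] inv[OF that(1)] inv[OF that(2)] bij
      add_subgroupD(4)[OF U(1)]
    by (metis bij_betw_def inv_into_f_f)
  show "\<omega> x y = \<omega> x' y' \<longleftrightarrow> \<omega> (inv_into U \<sigma> x) (inv_into U \<sigma> y) =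
      \<omega> (inv_into U \<sigma> x') (inv_into U \<sigma> y')" if "x \<in> W" "y \<in> W" "x' \<in> W" "y' \<in> W" for x y x' y'
    using pairing[of "inv_into U \<sigma> x" "inv_into U \<sigma> y" "inv_into U \<sigma> x'" "inv_into U \<sigma> y'"]
      inv that by simp
qed (use U W in auto)

end

text \<open>
The converse composition below is not an instance of this lemma: the inverse of the inverse of \<open>\<sigma>\<close>
is only known to agree with \<open>\<sigma>\<close> on \<open>U\<close>.
\<close>

lemma (in symplectic_correspondence) twist_inverse:
  "symplectic_correspondence.twist W (inv_into U \<sigma>) (twist P) = P"
proof -
  interpret inv: symplectic_correspondence \<omega> W U "inv_into U \<sigma>" by (rule inverse_correspondence)
  obtain v where v: "v \<in> U" "v \<noteq> 0" "emb P *s v \<in> U" using exists_multiplicand[of "{P}"] by auto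
  have si: "inv_into U \<sigma> (\<sigma> x) = x" if "x \<in> U" for x
    using bij that by (simp add: bij_betw_def)
  have "emb (twist P) *s \<sigma> v \<in> W" using semilinear v sigma_in by metis
  hence "inv_into U \<sigma> (emb (twist P) *s \<sigma> v) = emb (inv.twist (twist P)) *s v"
    using inv.semilinear[of "\<sigma> v" "twist P"] sigma_in v si by simp
  moreover have "inv_into U \<sigma> (emb (twist P) *s \<sigma> v) = emb P *s v"
    using semilinear[of v P] v si by metis
  ultimately have "emb (inv.twist (twist P)) *s v = emb P *s v" by metis
  thus ?thesis using v(2) by auto
qed

lemma (in symplectic_correspondence) twist_inverse':
  "twist (symplectic_correspondence.twist W (inv_into U \<sigma>) P) = P"
proof -
  interpret inv: symplectic_correspondence \<omega> W U "inv_into U \<sigma>" by (rule inverse_correspondence)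
  obtain w where w: "w \<in> W" "w \<noteq> 0" "emb P *s w \<in> W" using inv.exists_multiplicand[of "{P}"] by auto
  have si: "\<sigma> (inv_into U \<sigma> x) = x" if "x \<in> W" for x
    using bij that by (simp add: bij_betw_def f_inv_into_f)
  have "emb (inv.twist P) *s inv_into U \<sigma> w \<in> U" using inv.semilinear w inv.sigma_in by metis
  hence "\<sigma> (emb (inv.twist P) *s inv_into U \<sigma> w) = emb (twist (inv.twist P)) *s w"
    using semilinear[of "inv_into U \<sigma> w" "inv.twist P"] inv.sigma_in w si by simp
  moreover have "\<sigma> (emb (inv.twist P) *s inv_into U \<sigma> w) = emb P *s w"
    using inv.semilinear[of w P] w si by metis
  ultimately have "emb (twist (inv.twist P)) *s w = emb P *s w" by metis
  thus ?thesis using w(2) by auto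
qed

section \<open>Extending automorphisms from polynomials to Laurent series\<close>

lemma fls_subdegree_emb: "fls_subdegree (emb P) = - int (degree P)"
proof (cases "P = 0")
  case False
  show ?thesis
    by (rule fls_subdegree_eqI) (use False in \<open>auto simp: emb_nth intro!: coeff_eq_0\<close>)
qed simp

definition isometric_hom :: "('a::field fls \<Rightarrow> 'a fls) \<Rightarrow> bool" where
  "isometric_hom \<tau> \<longleftrightarrow> (\<forall>f g. \<tau> (f + g) = \<tau> f + \<tau> g) \<and> (\<forall>f g. \<tau> (f * g) = \<tau> f * \<tau> g) \<and>
     (\<forall>f. fls_subdegree (\<tau> f) = fls_subdegree f) \<and> \<tau> 1 = 1"

lemma isometric_homD:
  assumes "isometric_hom \<tau>"
  shows isometric_hom_add: "\<tau> (f + g) = \<tau> f + \<tau> g"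
    and isometric_hom_mult: "\<tau> (f * g) = \<tau> f * \<tau> g"
    and isometric_hom_subdegree: "fls_subdegree (\<tau> f) = fls_subdegree f"
    and isometric_hom_1: "\<tau> 1 = 1"
    and isometric_hom_0: "\<tau> 0 = 0"
    and isometric_hom_eq_0: "\<tau> f = 0 \<longleftrightarrow> f = 0"
    and isometric_hom_sum: "\<tau> (sum h S) = (\<Sum>x\<in>S. \<tau> (h x))"
    and isometric_hom_diff: "\<tau> (f - g) = \<tau> f - \<tau> g"
proof -
  show add: "\<tau> (f + g) = \<tau> f + \<tau> g" for f g using assms by (simp add: isometric_hom_def)
  show mult: "\<tau> (f * g) = \<tau> f * \<tau> g" for f g using assms by (simp add: isometric_hom_def)
  show "fls_subdegree (\<tau> f) = fls_subdegree f" using assms by (simp add: isometric_hom_def)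
  show 1: "\<tau> 1 = 1" using assms by (simp add: isometric_hom_def)
  show 0: "\<tau> 0 = 0" using add[of 0 0] by (metis add.right_neutral add_left_cancel)
  show "\<tau> f = 0 \<longleftrightarrow> f = 0" using mult[of f "inverse f"] 0 1 by (cases "f = 0") auto
  show "\<tau> (sum h S) = (\<Sum>x\<in>S. \<tau> (h x))"
    by (induction S rule: infinite_finite_induct) (simp_all add: 0 add)
  show "\<tau> (f - g) = \<tau> f - \<tau> g" using add[of "f - g" g] by (simp add: eq_diff_eq)
qed

text \<open>
An isometric ring endomorphism that fixes the polynomials in \<open>s\<close> also fixes \<open>t\<close>, hence the dense
subring of Laurent polynomials. Concretely, \<open>z = s\<^sup>N\<close> turns \<open>z * x\<close> into a polynomial plus a series
without constant term, where \<open>N\<close> is so large that a difference \<open>\<rho> x - x\<close> would already be visible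
in the polynomial part.
\<close>

lemma isometric_endomorphism_eq_id:
  fixes \<rho> :: "'a::field fls \<Rightarrow> 'a fls"
  assumes iso: "isometric_hom \<rho>" and emb: "\<And>P. \<rho> (emb P) = emb P"
  shows "\<rho> x = x"
proof (rule ccontr)
  note add = isometric_hom_add[OF iso] and mult = isometric_hom_mult[OF iso]
    and deg = isometric_hom_subdegree[OF iso]
  assume "\<rho> x \<noteq> x"
  define d where "d = \<rho> x - x"
  define N where "N = nat (fls_subdegree d)"
  have d: "d \<noteq> 0" using \<open>\<rho> x \<noteq> x\<close> by (simp add: d_def)
  define z :: "'a fls" where "z = emb (monom 1 N)"
  have z: "z \<noteq> 0" "fls_subdegree z = - int N" by (simp_all add: z_def fls_subdegree_emb degree_monom_eq)
  define r where "r = z * x - poly_part (z * x)"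
  have r: "fls_nth r n = 0" if "n \<le> 0" for n using that by (simp add: r_def poly_part_nth)
  have rho_0: "\<rho> 0 = 0" using emb[of 0] by simp
  have rho_r: "fls_nth (\<rho> r) n = 0" if "n \<le> 0" for n
  proof (cases "r = 0")
    case False
    have "0 < fls_subdegree r" using False r by (intro fls_subdegree_greaterI) auto
    thus ?thesis using that by (simp add: deg)
  qed (simp add: rho_0)
  have "z * x = r + poly_part (z * x)" by (simp add: r_def)
  hence "\<rho> (z * x) = \<rho> r + poly_part (z * x)" by (metis add emb poly_part_def)
  hence "z * d = \<rho> r - r" by (simp add: mult d_def z_def emb r_def algebra_simps)
  hence "fls_nth (z * d) n = 0" if "n \<le> 0" for n using r rho_r that by simp
  moreover have "fls_nth (z * d) (fls_subdegree (z * d)) \<noteq> 0"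
    by (rule nth_fls_subdegree_nonzero) (use d z in simp)
  moreover have "fls_subdegree (z * d) \<le> 0" using d z by (simp add: N_def)
  ultimately show False by blast
qed

definition fls_map_coeffs :: "('a::zero \<Rightarrow> 'b::zero) \<Rightarrow> 'a fls \<Rightarrow> 'b fls" where
  "fls_map_coeffs \<theta> f = Abs_fls (\<lambda>n. \<theta> (fls_nth f n))"

lemma fls_map_coeffs_nth [simp]: "\<theta> 0 = 0 \<Longrightarrow> fls_nth (fls_map_coeffs \<theta> f) n = \<theta> (fls_nth f n)"
  unfolding fls_map_coeffs_def
  by (rule nth_Abs_fls_lower_bound[of "fls_subdegree f"]) simp

context
  fixes \<theta> :: "'a::field \<Rightarrow> 'a"
  assumes add: "\<And>x y. \<theta> (x + y) = \<theta> x + \<theta> y"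
    and mult: "\<And>x y. \<theta> (x * y) = \<theta> x * \<theta> y"
    and one: "\<theta> 1 = 1"
begin

lemma hom_0: "\<theta> 0 = 0"
  using add[of 0 0] by (metis add.right_neutral add_left_cancel)

lemma hom_eq_0: "\<theta> x = 0 \<longleftrightarrow> x = 0"
  using mult[of x "inverse x"] by (cases "x = 0") (auto simp: hom_0 one)

lemma hom_sum: "\<theta> (sum f S) = (\<Sum>x\<in>S. \<theta> (f x))"
  by (induction S rule: infinite_finite_induct) (simp_all add: hom_0 add)

lemma fls_map_coeffs_add: "fls_map_coeffs \<theta> (f + g) = fls_map_coeffs \<theta> f + fls_map_coeffs \<theta> g"
  by (rule fls_eqI) (simp add: hom_0 add)

lemma fls_map_coeffs_eq_0: "fls_map_coeffs \<theta> f = 0 \<longleftrightarrow> f = 0"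
  by (simp add: fls_eq_iff hom_0 hom_eq_0)

lemma fls_map_coeffs_subdegree: "fls_subdegree (fls_map_coeffs \<theta> f) = fls_subdegree f"
proof (cases "f = 0")
  case True
  hence "fls_map_coeffs \<theta> f = 0" by (simp add: fls_map_coeffs_eq_0)
  thus ?thesis using True by simp
next
  case False
  show ?thesis by (rule fls_subdegree_eqI) (use False in \<open>simp_all add: hom_0 hom_eq_0\<close>)
qed

lemma fls_map_coeffs_mult: "fls_map_coeffs \<theta> (f * g) = fls_map_coeffs \<theta> f * fls_map_coeffs \<theta> g"
  by (rule fls_eqI) (simp add: fls_times_nth(2) fls_map_coeffs_subdegree hom_0 hom_sum mult)

lemma fls_map_coeffs_const: "fls_map_coeffs \<theta> (fls_const c) = fls_const (\<theta> c)"
  by (rule fls_eqI) (simp add: hom_0)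

lemma fls_map_coeffs_X_inv: "fls_map_coeffs \<theta> fls_X_inv = fls_X_inv"
  by (rule fls_eqI) (simp add: hom_0 one)

end

text \<open>
A surjective ring endomorphism of the polynomials sends constants to constants and, by
comparing degrees in a preimage of the variable, the variable to a polynomial \<open>y\<close> of degree one.
On Laurent series the extension applies \<open>\<theta>\<close> to the coefficients and substitutes the power series
\<open>inverse y\<close>, of order one, for \<open>t\<close>.
\<close>

lemma poly_automorphism_extends:
  fixes T :: "'a::field poly \<Rightarrow> 'a poly"
  assumes add: "\<And>P Q. T (P + Q) = T P + T Q"
    and mult: "\<And>P Q. T (P * Q) = T P * T Q"
    and one: "T 1 = 1"
    and surj: "surj T"
  shows "\<exists>\<tau>. isometric_hom \<tau> \<and> (\<forall>P. \<tau> (emb P) = emb (T P))"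
proof -
  define \<theta> where "\<theta> c = coeff (T [:c:]) 0" for c
  define y where "y = T [:0, 1:]"
  have T0: "T 0 = 0" using add[of 0 0] by (metis add.right_neutral add_left_cancel)
  have const: "T [:c:] = [:\<theta> c:]" for c
  proof (cases "c = 0")
    case False
    have "T [:c:] * T [:inverse c:] = 1"
      using False mult[of "[:c:]" "[:inverse c:]"] one by (simp flip: one_pCons)
    hence "T [:c:] dvd 1" by (metis dvd_triv_left)
    then obtain d where "T [:c:] = [:d:]" by (auto simp: is_unit_poly_iff)
    thus ?thesis by (simp add: \<theta>_def)
  qed (simp add: \<theta>_def T0)
  have t_add: "\<theta> (a + b) = \<theta> a + \<theta> b" for a b
    using add[of "[:a:]" "[:b:]"] by (simp add: const)
  have t_mult: "\<theta> (a * b) = \<theta> a * \<theta> b" for a b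
    using mult[of "[:a:]" "[:b:]"] by (simp add: const mult.commute)
  have t_one: "\<theta> 1 = 1" using one by (simp add: \<theta>_def flip: one_pCons)
  have t0: "\<theta> 0 = 0" by (simp add: \<theta>_def T0)
  note t = t_add t_mult t_one
  have T_pCons: "T (pCons c P) = [:\<theta> c:] + y * T P" for c P
    using add[of "[:c:]" "[:0, 1:] * P"] mult[of "[:0, 1:]" P] by (simp add: const y_def)
  have T_comp: "T P = pcompose (map_poly \<theta> P) y" for P
    by (induction P)
       (simp_all add: T0 T_pCons map_poly_pCons[where f = \<theta>] t0 pcompose_pCons)
  have deg: "degree (T P) = degree P * degree y" for P
    unfolding T_comp degree_pcompose
    by (subst degree_map_poly) (use hom_eq_0[OF t] in auto)
  obtain Q where "T Q = [:0, 1:]" using surj by (metis surjD)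
  hence "degree Q * degree y = 1" using deg[of Q] by simp
  hence deg_y: "degree y = 1" by simp
  define g where "g = fls_regpart (inverse (emb y))"
  have y0: "y \<noteq> 0" using deg_y by auto
  have sub: "fls_subdegree (inverse (emb y)) = 1" using deg_y by (simp add: fls_subdegree_emb)
  hence g: "fps_to_fls g = inverse (emb y)" by (simp add: g_def)
  have g1: "subdegree g = 1" using g sub by (metis fls_subdegree_fls_to_fps of_nat_1 of_nat_eq_iff)
  have g0: "g \<noteq> 0" "fps_nth g 0 = 0" using g1 by (auto intro: nth_less_subdegree_zero)
  define \<tau> where "\<tau> f = fls_compose_fps (fls_map_coeffs \<theta> f) g" for f
  have tau_add: "\<tau> (a + b) = \<tau> a + \<tau> b" for a b
    using g0 by (simp add: \<tau>_def fls_map_coeffs_add[OF t] fls_compose_fps_add)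
  have tau_mult: "\<tau> (a * b) = \<tau> a * \<tau> b" for a b
    using g0 by (simp add: \<tau>_def fls_map_coeffs_mult[OF t] fls_compose_fps_mult)
  have tau_const: "\<tau> (fls_const c) = fls_const (\<theta> c)" for c
    by (simp add: \<tau>_def fls_map_coeffs_const[OF t])
  have "\<tau> fls_X_inv = fls_compose_fps (inverse fls_X) g"
    by (simp add: \<tau>_def fls_map_coeffs_X_inv[OF t] fls_inverse_X)
  also have "\<dots> = emb y"
    using g0 by (subst fls_compose_fps_inverse) (simp_all add: g)
  finally have tau_X: "\<tau> fls_X_inv = emb y" .
  have tau_emb: "\<tau> (emb P) = emb (T P)" for P
  proof (induction P)
    case 0
    have "\<tau> 0 = 0" using tau_add[of 0 0] by (metis add.right_neutral add_left_cancel)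
    thus ?case using T0 by simp
  next
    case (pCons c P)
    have "emb [:\<theta> c:] = fls_const (\<theta> c)" by (simp add: emb_pCons)
    thus ?case using pCons
      by (simp add: emb_pCons T_pCons emb_add emb_mult tau_add tau_mult tau_const tau_X)
  qed
  have "fls_subdegree (\<tau> f) = fls_subdegree f" for f
    using g0 g1 by (simp add: \<tau>_def subdegree_fls_compose_fps fls_map_coeffs_subdegree[OF t])
  moreover have "\<tau> 1 = 1" using tau_emb[of 1] one by simp
  ultimately have "isometric_hom \<tau>" by (simp add: isometric_hom_def tau_add tau_mult)
  thus ?thesis using tau_emb by blast
qed

section \<open>The topology on Laurent series\<close>

lemma dist_fls_less_iff:
  "dist f g < inverse (2 ^ N) \<longleftrightarrow> (\<forall>n\<le>int N. fls_nth f n = fls_nth g n)"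
proof (cases "f = g")
  case False
  have "dist f g < inverse (2 ^ N) \<longleftrightarrow> int N < fls_subdegree (f - g)"
  proof (cases "fls_subdegree (f - g) \<ge> 0")
    case True
    thus ?thesis using False by (auto simp: dist_fls_def)
  next
    case neg: False
    have "inverse (2 ^ N) \<le> (1::real)" by (simp add: inverse_le_1_iff)
    also have "1 \<le> (2::real) ^ nat (- fls_subdegree (f - g))" by simp
    finally show ?thesis using False neg by (simp add: dist_fls_def)
  qed
  also have "\<dots> \<longleftrightarrow> (\<forall>n\<le>int N. fls_nth (f - g) n = 0)"
    using False by (auto intro!: fls_subdegree_greaterI simp del: fls_minus_nth)
  finally show ?thesis by simp
qed simp

lemma inverse_power2_less:
  assumes "0 < (e::real)"
  obtains N where "inverse (2 ^ N) < e"
  using real_arch_pow_inv[OF assms, of "1 / 2"] that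
  by (auto simp: power_one_over inverse_eq_divide)

lemma dist_fls_add:
  fixes a b :: "'a::ab_group_add fls"
  assumes "dist f a < inverse (2 ^ N)" "dist g b < inverse (2 ^ N)"
  shows "dist (f + g) (a + b) < inverse (2 ^ N)"
  using assms unfolding dist_fls_less_iff by simp

instance fls :: (ab_group_add) topological_ab_group_add
proof
  fix a b :: "'a fls"
  show "((\<lambda>x. fst x + snd x) \<longlongrightarrow> a + b) (nhds a \<times>\<^sub>F nhds b)"
    unfolding tendsto_iff
  proof (intro allI impI)
    fix e :: real assume "0 < e"
    then obtain N where N: "inverse (2 ^ N) < e" by (rule inverse_power2_less)
    have ev: "\<forall>\<^sub>F x in nhds c. dist x c < inverse (2 ^ N)" for c :: "'a fls"
      by (rule eventually_nhds_metric[THEN iffD2]) (auto intro!: exI[of _ "inverse (2 ^ N)"])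
    show "\<forall>\<^sub>F x in nhds a \<times>\<^sub>F nhds b. dist (fst x + snd x) (a + b) < e"
      using eventually_prodI[OF ev[of a] ev[of b]]
      by eventually_elim (use dist_fls_add N in fastforce)
  qed
  show "(uminus \<longlongrightarrow> - a) (nhds a)"
    unfolding tendsto_iff
  proof (intro allI impI)
    fix e :: real assume e: "0 < e"
    have d: "dist (- x) (- a) = dist x a" for x
    proof -
      have "- x + a = - (x - a)" by simp
      hence "fls_subdegree (- x + a) = fls_subdegree (x - a)" by (metis fls_uminus_subdegree)
      thus ?thesis by (simp add: dist_fls_def)
    qed
    show "\<forall>\<^sub>F x in nhds a. dist (- x) (- a) < e"
      unfolding d eventually_nhds_metric using e by auto
  qed
qed

lemma continuous_on_fls_mult_left:
  fixes c :: "'a::field fls"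
  assumes "continuous_on S f"
  shows "continuous_on S (\<lambda>x. c * f x)"
proof -
  have "continuous_on UNIV ((*) c)"
  proof (cases "c = 0")
    case False
    show ?thesis unfolding continuous_on_iff
    proof (intro ballI allI impI)
      fix x :: "'a fls" and e :: real assume "0 < e"
      then obtain N where N: "inverse (2 ^ N) < e" by (rule inverse_power2_less)
      define M where "M = N + nat (- fls_subdegree c)"
      have "dist (c * y) (c * x) < e" if y: "dist y x < inverse (2 ^ M)" for y
      proof (cases "y = x")
        case neq: False
        have "int M < fls_subdegree (y - x)"
          using y neq unfolding dist_fls_less_iff by (intro fls_subdegree_greaterI) auto
        moreover have "fls_subdegree (c * (y - x)) = fls_subdegree c + fls_subdegree (y - x)"
          using False neq by (intro fls_subdegree_mult) auto
        ultimately have "int N < fls_subdegree (c * (y - x))" unfolding M_def by linarith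
        hence "fls_nth (c * (y - x)) n = 0" if "n \<le> int N" for n
          using that by (intro fls_eq0_below_subdegree) linarith
        hence "dist (c * y) (c * x) < inverse (2 ^ N)"
          unfolding dist_fls_less_iff by (simp add: right_diff_distrib)
        thus ?thesis using N by simp
      qed (use \<open>0 < e\<close> in simp)
      thus "\<exists>d>0. \<forall>x'\<in>UNIV. dist x' x < d \<longrightarrow> dist (c * x') (c * x) < e"
        by (intro exI[of _ "inverse (2 ^ M)"]) auto
    qed
  qed simp
  from continuous_on_compose2[OF this assms] show ?thesis by simp
qed

lemma continuous_on_matrix_vector_mult:
  fixes A :: "'a::field fls ^ 'n ^ 'm"
  assumes "continuous_on S f"
  shows "continuous_on S (\<lambda>x. A *v f x)"
  unfolding matrix_vector_mult_def
  by (intro continuous_on_vec_lambda continuous_on_sum continuous_on_fls_mult_left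
      continuous_on_component assms)

lemma isometry_continuous:
  fixes \<tau> :: "'a::field fls \<Rightarrow> 'a fls"
  assumes add: "\<And>f g. \<tau> (f + g) = \<tau> f + \<tau> g"
    and sub: "\<And>f. fls_subdegree (\<tau> f) = fls_subdegree f"
    and inj: "\<And>f. \<tau> f = 0 \<Longrightarrow> f = 0"
  shows "continuous_on S \<tau>"
proof -
  have diff: "\<tau> (f - g) = \<tau> f - \<tau> g" for f g
    using add[of "f - g" g] by (simp add: eq_diff_eq)
  have "dist (\<tau> f) (\<tau> g) = dist f g" for f g
    using sub[of "f - g"] inj[of "f - g"] by (auto simp: dist_fls_def diff)
  thus ?thesis unfolding continuous_on_iff by auto
qed

definition poly_part_vec :: "'a::field fls ^ 'n \<Rightarrow> 'a fls ^ 'n" where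
  "poly_part_vec v = (\<chi> i. poly_part (v $ i))"

lemma poly_part_vec_in: "poly_part_vec v \<in> F_minus_vec"
  by (simp add: poly_part_vec_def F_minus_vec_def)

lemma poly_part_vec_id: "v \<in> F_minus_vec \<Longrightarrow> poly_part_vec v = v"
  by (simp add: poly_part_vec_def F_minus_vec_def vec_eq_iff poly_part_id)

lemma poly_part_vec_add: "poly_part_vec (v + w) = poly_part_vec v + poly_part_vec w"
  by (simp add: poly_part_vec_def vec_eq_iff poly_part_add)

lemma poly_part_eqI: "dist f g < 1 \<Longrightarrow> poly_part f = poly_part g"
  using dist_fls_less_iff[of f g 0] by (intro fls_eqI) (simp add: poly_part_nth)

lemma open_vec_ball: "open {w :: 'a::field fls ^ 'n. \<forall>i. dist (w $ i) (v $ i) < e}"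
proof -
  have "open {w :: 'a fls ^ 'n. w $ i \<in> ball (v $ i) e}" for i
    by (intro open_vimage_vec_nth[unfolded vimage_def] open_ball)
  hence "open (\<Inter>i. {w :: 'a fls ^ 'n. w $ i \<in> ball (v $ i) e})" by (intro open_INT) auto
  moreover have "(\<Inter>i. {w :: 'a fls ^ 'n. w $ i \<in> ball (v $ i) e}) = {w. \<forall>i. dist (w $ i) (v $ i) < e}"
    by (auto simp: dist_commute)
  ultimately show ?thesis by simp
qed

text \<open>
The polynomial part is locally constant, so it can be followed by any map whatsoever.
\<close>

lemma continuous_on_poly_part_vec:
  fixes g :: "'a::field fls ^ 'n \<Rightarrow> 'b::topological_space"
  shows "continuous_on UNIV (\<lambda>v. g (poly_part_vec v))"
  unfolding continuous_on_eq_continuous_at[OF open_UNIV]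
proof
  fix v :: "'a fls ^ 'n"
  let ?B = "{w :: 'a fls ^ 'n. \<forall>i. dist (w $ i) (v $ i) < 1}"
  have "g (poly_part_vec w) = g (poly_part_vec v)" if "w \<in> ?B" for w
    using that by (auto simp: poly_part_vec_def vec_eq_iff intro!: arg_cong[of _ _ g] poly_part_eqI)
  hence "\<forall>\<^sub>F w in nhds v. g (poly_part_vec w) = g (poly_part_vec v)"
    unfolding eventually_nhds
  proof (intro exI[of _ ?B] conjI open_vec_ball ballI)
    show "v \<in> ?B" by simp
  qed
  thus "isCont (\<lambda>v. g (poly_part_vec v)) v"
    by (subst isCont_cong) auto
qed

section \<open>Extending additive maps in prime characteristic\<close>

lemma add_subgroup_of_int:
  fixes M :: "('a::field fls ^ 'n) set"
  assumes "add_subgroup M" "x \<in> M"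
  shows "of_int z *s x \<in> M"
proof (induction z rule: int_induct[where k = 0])
  case base
  show ?case using add_subgroupD(1)[OF assms(1)] by simp
next
  case (step1 i)
  thus ?case using add_subgroupD(4)[OF assms(1) _ assms(2)] by (simp add: vector_sadd_rdistrib)
next
  case (step2 i)
  thus ?case using add_subgroupD(2)[OF assms(1) _ assms(2)] by (simp add: vector_ssub_ldistrib)
qed

context
  fixes p :: nat
  assumes p: "prime p" and char: "of_nat p = (0 :: 'a::field fls)"
begin

lemma of_int_char_dvd: "int p dvd z \<Longrightarrow> of_int z = (0 :: 'a fls)"
  using char by (metis dvd_def mult_zero_left of_int_mult of_int_of_nat_eq)

text \<open>
As \<open>p\<close> annihilates everything, the additive group is a vector space over the prime field: a new
vector \<open>c\<close> either lies in \<open>M\<close> or is independent of it, and in the latter case the extension may be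
chosen to vanish at \<open>c\<close>. The well-definedness argument inverts an integer modulo \<open>p\<close>.
\<close>

lemma additive_extension_insert:
  fixes M :: "('a fls ^ 'n) set" and \<eta> :: "'a fls ^ 'n \<Rightarrow> 'a fls"
  assumes M: "add_subgroup M" and add: "\<And>x y. x \<in> M \<Longrightarrow> y \<in> M \<Longrightarrow> \<eta> (x + y) = \<eta> x + \<eta> y"
  shows "\<exists>M' \<eta>'. add_subgroup M' \<and> insert c M \<subseteq> M' \<and> (\<forall>x\<in>M. \<eta>' x = \<eta> x) \<and>
      (\<forall>x\<in>M'. \<forall>y\<in>M'. \<eta>' (x + y) = \<eta>' x + \<eta>' y)"
proof (cases "c \<in> M")
  case True
  thus ?thesis using assms by (intro exI[of _ M] exI[of _ \<eta>]) auto
next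
  case c: False
  have uniq: "u = u'" if "u \<in> M" "u' \<in> M" "u + of_int z *s c = u' + of_int z' *s c" for u u' z z'
  proof -
    have diff: "u - u' = of_int (z' - z) *s c" using that(3) by (simp add: algebra_simps)
    have "int p dvd z' - z"
    proof (rule ccontr)
      assume "\<not> ?thesis"
      hence "coprime (int p) (z' - z)" using p by (intro prime_imp_coprime) auto
      then obtain k l where kl: "k * int p + l * (z' - z) = 1"
        using bezout_int[of "int p" "z' - z"] by auto
      have "c = of_int (k * int p + l * (z' - z)) *s c" unfolding kl by simp
      also have "\<dots> = of_int l *s (u - u')"
        using char by (simp add: diff del: of_int_diff)
      also have "\<dots> \<in> M" using that M by (intro add_subgroup_of_int add_subgroupD(2))
      finally show False using c by blast
    qed
    from of_int_char_dvd[OF this] have "u - u' = 0" unfolding diff by simp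
    thus ?thesis by simp
  qed
  define M' where "M' = {u + of_int z *s c | u z. u \<in> M}"
  define \<eta>' where "\<eta>' x = \<eta> (SOME u. u \<in> M \<and> (\<exists>z. x = u + of_int z *s c))" for x
  have eta': "\<eta>' (u + of_int z *s c) = \<eta> u" if "u \<in> M" for u z
  proof -
    have "(SOME u'. u' \<in> M \<and> (\<exists>z'. u + of_int z *s c = u' + of_int z' *s c)) = u"
      by (rule some_equality) (use that uniq in blast)+
    thus ?thesis by (simp add: \<eta>'_def)
  qed
  have 1: "add_subgroup M'"
    unfolding add_subgroup_def
  proof (intro conjI ballI)
    show "0 \<in> M'" unfolding M'_def using add_subgroupD(1)[OF M]
      by (auto intro!: exI[of _ "0::'a fls ^ 'n"] exI[of _ "0::int"])
    fix x y assume "x \<in> M'" "y \<in> M'"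
    then obtain u z u' z' where *: "x = u + of_int z *s c" "y = u' + of_int z' *s c" "u \<in> M" "u' \<in> M"
      unfolding M'_def by blast
    have "x - y = (u - u') + of_int (z - z') *s c" by (simp add: * vector_sub_rdistrib)
    thus "x - y \<in> M'" unfolding M'_def using add_subgroupD(2)[OF M *(3,4)] by blast
  qed
  have 2: "x \<in> M'" "\<eta>' x = \<eta> x" if "x \<in> M" for x
  proof -
    have x: "x = x + of_int 0 *s c" by simp
    show "x \<in> M'" unfolding M'_def using that x by blast
    show "\<eta>' x = \<eta> x" using eta'[OF that, of 0] by simp
  qed
  have 3: "c \<in> M'"
  proof -
    have "c = 0 + of_int 1 *s c" by simp
    thus ?thesis unfolding M'_def using add_subgroupD(1)[OF M] by blast
  qed
  have 4: "\<eta>' (x + y) = \<eta>' x + \<eta>' y" if "x \<in> M'" "y \<in> M'" for x y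
  proof -
    obtain u z u' z' where *: "x = u + of_int z *s c" "y = u' + of_int z' *s c" "u \<in> M" "u' \<in> M"
      using \<open>x \<in> M'\<close> \<open>y \<in> M'\<close> unfolding M'_def by blast
    have "x + y = (u + u') + of_int (z + z') *s c" by (simp add: * vector_sadd_rdistrib)
    hence "\<eta>' (x + y) = \<eta> (u + u')" using eta' add_subgroupD(4)[OF M *(3,4)] by metis
    also have "\<dots> = \<eta>' x + \<eta>' y" using *(3,4) by (simp add: add *(1,2) eta')
    finally show ?thesis .
  qed
  show ?thesis
    using 1 2 3 4 by (intro exI[of _ M'] exI[of _ \<eta>']) blast
qed

lemma additive_extension_finite:
  fixes M :: "('a fls ^ 'n) set" and \<eta> :: "'a fls ^ 'n \<Rightarrow> 'a fls"
  assumes "finite C" and M: "add_subgroup M"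
    and add: "\<And>x y. x \<in> M \<Longrightarrow> y \<in> M \<Longrightarrow> \<eta> (x + y) = \<eta> x + \<eta> y"
  shows "\<exists>M' \<eta>'. add_subgroup M' \<and> C \<union> M \<subseteq> M' \<and> (\<forall>x\<in>M. \<eta>' x = \<eta> x) \<and>
      (\<forall>x\<in>M'. \<forall>y\<in>M'. \<eta>' (x + y) = \<eta>' x + \<eta>' y)"
  using assms(1)
proof (induction C)
  case empty
  show ?case using assms by (intro exI[of _ M] exI[of _ \<eta>]) auto
next
  case (insert c C)
  then obtain M1 \<eta>1 where 1: "add_subgroup M1" "C \<union> M \<subseteq> M1" "\<forall>x\<in>M. \<eta>1 x = \<eta> x"
    "\<forall>x\<in>M1. \<forall>y\<in>M1. \<eta>1 (x + y) = \<eta>1 x + \<eta>1 y" by blast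
  have "\<exists>M' \<eta>'. add_subgroup M' \<and> insert c M1 \<subseteq> M' \<and> (\<forall>x\<in>M1. \<eta>' x = \<eta>1 x) \<and>
      (\<forall>x\<in>M'. \<forall>y\<in>M'. \<eta>' (x + y) = \<eta>' x + \<eta>' y)"
    by (rule additive_extension_insert) (use 1 in auto)
  then obtain M2 \<eta>2 where 2: "add_subgroup M2" "insert c M1 \<subseteq> M2" "\<forall>x\<in>M1. \<eta>2 x = \<eta>1 x"
    "\<forall>x\<in>M2. \<forall>y\<in>M2. \<eta>2 (x + y) = \<eta>2 x + \<eta>2 y" by blast
  have "\<forall>x\<in>M. \<eta>2 x = \<eta> x" using 1 2 by auto
  thus ?case using 1 2 by (intro exI[of _ M2] exI[of _ \<eta>2] conjI) auto
qed

lemma additive_extension: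
  fixes M :: "('a fls ^ 'n) set" and \<eta> :: "'a fls ^ 'n \<Rightarrow> 'a fls"
  assumes M: "add_subgroup M" and fin: "fin_quot (-) M B"
    and add: "\<And>x y. x \<in> M \<Longrightarrow> y \<in> M \<Longrightarrow> \<eta> (x + y) = \<eta> x + \<eta> y"
  shows "\<exists>\<eta>'. (\<forall>x\<in>M. \<eta>' x = \<eta> x) \<and> (\<forall>x\<in>B. \<forall>y\<in>B. \<eta>' (x + y) = \<eta>' x + \<eta>' y)"
proof -
  obtain C where C: "finite C" "\<forall>b\<in>B. \<exists>c\<in>C. b - c \<in> M" using fin_quot_reps[OF fin] by blast
  have "\<exists>M' \<eta>'. add_subgroup M' \<and> C \<union> M \<subseteq> M' \<and> (\<forall>x\<in>M. \<eta>' x = \<eta> x) \<and>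
      (\<forall>x\<in>M'. \<forall>y\<in>M'. \<eta>' (x + y) = \<eta>' x + \<eta>' y)"
    by (rule additive_extension_finite[OF C(1) M add])
  then obtain M' \<eta>' where *: "add_subgroup M'" "C \<union> M \<subseteq> M'" "\<forall>x\<in>M. \<eta>' x = \<eta> x"
    "\<forall>x\<in>M'. \<forall>y\<in>M'. \<eta>' (x + y) = \<eta>' x + \<eta>' y" by blast
  have "B \<subseteq> M'"
  proof
    fix b assume "b \<in> B"
    then obtain c where "c \<in> C" "b - c \<in> M" using C by blast
    hence "(b - c) + c \<in> M'" using * by (intro add_subgroupD(4)) auto
    thus "b \<in> M'" by simp
  qed
  thus ?thesis using * by blast
qed

end

section \<open>Semilinear extension of a symplectic correspondence\<close>

lemma isometric_hom_compose:
  "isometric_hom \<tau> \<Longrightarrow> isometric_hom \<tau>' \<Longrightarrow> isometric_hom (\<lambda>f. \<tau> (\<tau>' f))"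
  by (simp add: isometric_hom_def)

lemma isometric_hom_continuous:
  assumes "isometric_hom \<tau>" "continuous_on S f"
  shows "continuous_on S (\<lambda>x. \<tau> (f x))"
proof -
  have "continuous_on UNIV \<tau>"
    by (rule isometry_continuous) (simp_all add: isometric_homD[OF assms(1)])
  from continuous_on_compose2[OF this assms(2)] show ?thesis by simp
qed

definition vmap :: "('a \<Rightarrow> 'b) \<Rightarrow> 'a ^ 'n \<Rightarrow> 'b ^ 'n" where
  "vmap \<tau> x = (\<chi> i. \<tau> (x $ i))"

lemma vmap_nth [simp]: "vmap \<tau> x $ i = \<tau> (x $ i)"
  by (simp add: vmap_def)

definition inverse_isometries :: "('a::field fls \<Rightarrow> 'a fls) \<Rightarrow> ('a fls \<Rightarrow> 'a fls) \<Rightarrow> bool" where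
  "inverse_isometries \<tau> \<tau>' \<longleftrightarrow> isometric_hom \<tau> \<and> isometric_hom \<tau>' \<and>
     (\<forall>f. \<tau> (\<tau>' f) = f) \<and> (\<forall>f. \<tau>' (\<tau> f) = f)"

lemma vmap_add: "isometric_hom \<tau> \<Longrightarrow> vmap \<tau> (x + y) = vmap \<tau> x + vmap \<tau> y"
  by (simp add: vec_eq_iff isometric_hom_add)

lemma vmap_continuous:
  assumes "isometric_hom \<tau>" "continuous_on S f"
  shows "continuous_on S (\<lambda>x. vmap \<tau> (f x))"
  unfolding vmap_def
  by (rule continuous_on_vec_lambda, rule isometric_hom_continuous[OF assms(1)],
      rule continuous_on_component[OF assms(2)])

context symplectic_correspondence
begin

lemma sigma_sum:
  assumes "finite S" "\<And>i. i \<in> S \<Longrightarrow> f i \<in> U"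
  shows "sum f S \<in> U \<and> \<sigma> (sum f S) = (\<Sum>i\<in>S. \<sigma> (f i))"
  using assms
proof (induction S)
  case empty
  show ?case using sigma_0 add_subgroupD(1)[OF U(1)] by simp
next
  case (insert i S)
  thus ?case using additive add_subgroupD(4)[OF U(1)] by simp
qed

lemma field_automorphism:
  "\<exists>\<tau> \<tau>'. inverse_isometries \<tau> \<tau>' \<and> (\<forall>P. \<tau> (emb P) = emb (twist P))"
proof -
  interpret inv: symplectic_correspondence \<omega> W U "inv_into U \<sigma>" by (rule inverse_correspondence)
  have "surj twist" using twist_inverse' by (rule surjI)
  from poly_automorphism_extends[OF twist_add twist_mult twist_1 this]
  obtain \<tau> where t: "isometric_hom \<tau>" "\<And>P. \<tau> (emb P) = emb (twist P)" by blast
  have "surj inv.twist" using twist_inverse by (rule surjI)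
  from poly_automorphism_extends[OF inv.twist_add inv.twist_mult inv.twist_1 this]
  obtain \<tau>' where t': "isometric_hom \<tau>'" "\<And>P. \<tau>' (emb P) = emb (inv.twist P)" by blast
  have "\<tau> (\<tau>' f) = f" for f
    by (rule isometric_endomorphism_eq_id[OF isometric_hom_compose[OF t(1) t'(1)]])
      (simp add: t t' twist_inverse')
  moreover have "\<tau>' (\<tau> f) = f" for f
    by (rule isometric_endomorphism_eq_id[OF isometric_hom_compose[OF t'(1) t(1)]])
      (simp add: t t' twist_inverse)
  ultimately have "inverse_isometries \<tau> \<tau>'" using t(1) t'(1) by (simp add: inverse_isometries_def)
  thus ?thesis using t(2) by blast
qed

text \<open>
The values \<open>Z = \<omega> v w\<close> and \<open>Z' = \<omega> v' w'\<close> satisfy \<open>\<omega> (Z' v) w = \<omega> (Z v') w'\<close>. Transporting this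
equality by \<open>\<sigma>\<close>, after a multiplication by \<open>e\<close> that brings the vectors into \<open>U\<close>, shows that the ratio
of \<open>\<omega> (\<sigma> v) (\<sigma> w)\<close> to the twist of \<open>\<omega> v w\<close> is constant.
\<close>

lemma pairing_ratio:
  assumes "v \<in> U" "w \<in> U" "v' \<in> U" "w' \<in> U" "\<omega> v w = emb Z" "\<omega> v' w' = emb Z'"
  shows "emb (twist Z') * \<omega> (\<sigma> v) (\<sigma> w) = emb (twist Z) * \<omega> (\<sigma> v') (\<sigma> w')"
proof -
  have vR: "v \<in> F_minus_vec" "v' \<in> F_minus_vec" using assms U(2) by auto
  obtain e where e: "e \<noteq> 0" "emb e *s (emb Z' *s v) \<in> U" "emb e *s (emb Z *s v') \<in> U"
    using common_multiplier[OF U(3), of "{emb Z' *s v, emb Z *s v'}"] vR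
    by (auto simp: F_minus_vec_scale)
  have e': "emb (e * Z') *s v \<in> U" "emb (e * Z) *s v' \<in> U" using e by (simp_all add: emb_mult)
  have "\<omega> (emb (e * Z') *s v) w = \<omega> (emb (e * Z) *s v') w'"
    by (simp add: scale_left assms emb_mult)
  hence "\<omega> (\<sigma> (emb (e * Z') *s v)) (\<sigma> w) = \<omega> (\<sigma> (emb (e * Z) *s v')) (\<sigma> w')"
    using pairing e' assms by blast
  hence "emb (twist e) * (emb (twist Z') * \<omega> (\<sigma> v) (\<sigma> w)) =
      emb (twist e) * (emb (twist Z) * \<omega> (\<sigma> v') (\<sigma> w'))"
    using semilinear[OF assms(1) e'(1)] semilinear[OF assms(3) e'(2)]
    by (simp add: scale_left twist_mult emb_mult mult.assoc)
  moreover have "twist e \<noteq> 0"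
  proof
    assume "twist e = 0"
    moreover have "twist 0 = 0" using twist_add[of 0 0] by (metis add.right_neutral add_left_cancel)
    ultimately show False using e(1) twist_inverse[of e] twist_inverse[of 0] by simp
  qed
  ultimately show ?thesis by simp
qed

lemma pairing_factor:
  assumes "\<And>P. \<tau> (emb P) = emb (twist P)"
    and "isometric_hom \<tau>"
  shows "\<exists>c. c \<noteq> 0 \<and> (\<forall>v\<in>U. \<forall>w\<in>U. \<omega> (\<sigma> v) (\<sigma> w) = c * \<tau> (\<omega> v w))"
proof -
  obtain v0 where v0: "v0 \<in> U" "v0 \<noteq> 0" using exists_multiplicand[of "{}"] by auto
  obtain w0 where w0: "w0 \<in> U" "\<omega> v0 w0 \<noteq> 0" by (rule exists_nonorthogonal[OF U(3) v0(2)])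
  have int: "\<exists>Z. \<omega> v w = emb Z" if "v \<in> U" "w \<in> U" for v w
    using integral[of v w] that U(2) by (auto simp: F_minus_emb)
  obtain Z0 where Z0: "\<omega> v0 w0 = emb Z0" using int v0 w0 by blast
  have t0: "\<tau> (\<omega> v0 w0) \<noteq> 0" using w0(2) by (simp add: isometric_hom_eq_0[OF assms(2)])
  show ?thesis
  proof (intro exI[of _ "\<omega> (\<sigma> v0) (\<sigma> w0) / \<tau> (\<omega> v0 w0)"] conjI ballI)
    show "\<omega> (\<sigma> v0) (\<sigma> w0) / \<tau> (\<omega> v0 w0) \<noteq> 0"
      using t0 pairing_0[OF v0(1) w0(1)] w0(2) by simp
    fix v w assume vw: "v \<in> U" "w \<in> U"
    then obtain Z where Z: "\<omega> v w = emb Z" using int by blast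
    have "\<tau> (\<omega> v0 w0) * \<omega> (\<sigma> v) (\<sigma> w) = \<tau> (\<omega> v w) * \<omega> (\<sigma> v0) (\<sigma> w0)"
      using pairing_ratio[OF vw v0(1) w0(1) Z Z0] by (simp add: Z Z0 assms(1))
    thus "\<omega> (\<sigma> v) (\<sigma> w) = \<omega> (\<sigma> v0) (\<sigma> w0) / \<tau> (\<omega> v0 w0) * \<tau> (\<omega> v w)"
      using t0 by (simp add: field_simps)
  qed
qed

lemma omega_expand: "\<omega> x y = (\<Sum>i\<in>UNIV. \<Sum>j\<in>UNIV. x $ i * (y $ j * \<omega> (axis i 1) (axis j 1)))"
proof -
  have "\<omega> x y = \<omega> (\<Sum>i\<in>UNIV. x $ i *s axis i 1) (\<Sum>j\<in>UNIV. y $ j *s axis j 1)"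
    by (simp only: basis_expansion)
  also have "\<dots> = (\<Sum>i\<in>UNIV. \<Sum>j\<in>UNIV. x $ i * (y $ j * \<omega> (axis i 1) (axis j 1)))"
    unfolding sum_left scale_left unfolding sum_right scale_right sum_distrib_left ..
  finally show ?thesis .
qed

text \<open>
The matrix \<open>A\<close> is determined by the images of multiples \<open>b i\<close> of the standard basis that lie in \<open>U\<close>.
It is invertible because the transformed form is again nondegenerate.
\<close>

theorem semilinear_extension:
  "\<exists>\<tau> \<tau>' c A B. inverse_isometries \<tau> \<tau>' \<and> c \<noteq> 0 \<and> A ** B = mat 1 \<and> B ** A = mat 1 \<and>
     (\<forall>x y. \<omega> (A *v vmap \<tau> x) (A *v vmap \<tau> y) = c * \<tau> (\<omega> x y)) \<and>
     (\<forall>v\<in>U. A *v vmap \<tau> v = \<sigma> v)"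
proof -
  obtain \<tau> \<tau>' where iso: "inverse_isometries \<tau> \<tau>'" and tau_emb: "\<And>P. \<tau> (emb P) = emb (twist P)"
    using field_automorphism by blast
  have t: "isometric_hom \<tau>" "isometric_hom \<tau>'" "\<tau> (\<tau>' f) = f" "\<tau>' (\<tau> f) = f" for f
    using iso by (simp_all add: inverse_isometries_def)
  obtain c where c: "c \<noteq> 0" "\<And>v w. v \<in> U \<Longrightarrow> w \<in> U \<Longrightarrow> \<omega> (\<sigma> v) (\<sigma> w) = c * \<tau> (\<omega> v w)"
    using pairing_factor[of \<tau>, OF tau_emb t(1)] by blast
  have "range (\<lambda>i. axis i 1 :: 'a fls ^ 'n) \<subseteq> F_minus_vec" using axis_in by auto
  then obtain d where d: "d \<noteq> 0" "\<And>i. emb d *s axis i 1 \<in> U"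
    using common_multiplier[OF U(3), of "range (\<lambda>i. axis i 1 :: 'a fls ^ 'n)"] by auto
  define b :: "'n \<Rightarrow> 'a fls ^ 'n" where "b i = emb d *s axis i 1" for i
  have b: "b i \<in> U" for i using d by (simp add: b_def)
  define u where "u i = inverse (\<tau> (emb d)) *s \<sigma> (b i)" for i
  define A :: "'a fls ^ 'n ^ 'n" where "A = (\<chi> j i. u i $ j)"
  have td: "\<tau> (emb d) \<noteq> 0" using d(1) by (simp add: isometric_hom_eq_0[OF t(1)])
  have A: "A *v vmap \<tau> x = (\<Sum>i\<in>UNIV. \<tau> (x $ i) *s u i)" for x
    by (simp add: A_def vec_eq_iff matrix_vector_mult_def mult.commute)
  have uu: "\<omega> (u i) (u j) = c * \<tau> (\<omega> (axis i 1) (axis j 1))" for i j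
  proof -
    have "\<omega> (\<sigma> (b i)) (\<sigma> (b j)) = c * (\<tau> (emb d) * (\<tau> (emb d) * \<tau> (\<omega> (axis i 1) (axis j 1))))"
      using c(2)[OF b b] by (simp add: b_def scale_left scale_right isometric_hom_mult[OF t(1)])
    thus ?thesis using td by (simp add: u_def scale_left scale_right field_simps)
  qed
  have form: "\<omega> (A *v vmap \<tau> x) (A *v vmap \<tau> y) = c * \<tau> (\<omega> x y)" for x y
  proof -
    have "\<omega> (A *v vmap \<tau> x) (A *v vmap \<tau> y) =
        (\<Sum>i\<in>UNIV. \<Sum>j\<in>UNIV. \<tau> (x $ i) * (\<tau> (y $ j) * \<omega> (u i) (u j)))"
      unfolding A sum_left scale_left unfolding sum_right scale_right sum_distrib_left ..
    also have "\<dots> = c * (\<Sum>i\<in>UNIV. \<Sum>j\<in>UNIV. \<tau> (x $ i * (y $ j * \<omega> (axis i 1) (axis j 1))))"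
      by (simp add: uu isometric_hom_mult[OF t(1)] sum_distrib_left mult_ac)
    also have "\<dots> = c * \<tau> (\<omega> x y)"
      by (subst (2) omega_expand) (simp only: isometric_hom_sum[OF t(1)])
    finally show ?thesis .
  qed
  have ker: "x = 0" if "A *v x = 0" for x
  proof -
    have x: "vmap \<tau> (vmap \<tau>' x) = x" by (simp add: vec_eq_iff t)
    have "c * \<tau> (\<omega> (vmap \<tau>' x) y) = 0" for y
      using form[of "vmap \<tau>' x" y] that x by simp
    hence "\<omega> (vmap \<tau>' x) y = 0" for y using c(1) by (simp add: isometric_hom_eq_0[OF t(1)])
    hence "vmap \<tau>' x = 0" by (rule nondegenerate)
    hence "vmap \<tau> 0 = x" using x by simp
    thus ?thesis by (simp add: vec_eq_iff isometric_hom_0[OF t(1)])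
  qed
  have "\<forall>x. A *v x = 0 \<longrightarrow> x = 0" using ker by simp
  from matrix_left_invertible_ker[THEN iffD2, OF this] obtain B where B: "B ** A = mat 1" ..
  have B': "A ** B = mat 1" using B by (simp add: matrix_left_right_inverse)
  have ext: "A *v vmap \<tau> v = \<sigma> v" if v: "v \<in> U" for v
  proof -
    have vR: "v \<in> F_minus_vec" using v U(2) by auto
    hence "\<forall>i. \<exists>P. v $ i = emb P" by (auto simp: F_minus_vec_def F_minus_emb)
    then obtain P where P: "\<And>i. v $ i = emb (P i)" by metis
    have "range (\<lambda>i. emb (P i) *s b i) \<subseteq> F_minus_vec"
      using b U(2) by (auto intro!: F_minus_vec_scale)
    then obtain e where e: "e \<noteq> 0" "\<And>i. emb e *s (emb (P i) *s b i) \<in> U"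
      using common_multiplier[OF U(3), of "range (\<lambda>i. emb (P i) *s b i)"] by auto
    have e': "emb (e * P i) *s b i \<in> U" for i using e(2)[of i] by (simp add: emb_mult)
    \<comment> \<open>\<open>e * d\<close> makes \<open>v\<close> a sum of vectors \<open>emb (e * P i) *s b i\<close> each of which lies in \<open>U\<close>\<close>
    have "emb (e * d) *s v = (\<Sum>i\<in>UNIV. emb (e * d) *s (v $ i *s axis i 1))"
      by (simp only: basis_expansion flip: vec.scale_sum_right)
    also have "\<dots> = (\<Sum>i\<in>UNIV. emb (e * P i) *s b i)"
      by (simp add: P b_def emb_mult mult_ac)
    finally have edv: "emb (e * d) *s v = (\<Sum>i\<in>UNIV. emb (e * P i) *s b i)" .
    have sum: "(\<Sum>i\<in>UNIV. emb (e * P i) *s b i) \<in> U"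
      "\<sigma> (\<Sum>i\<in>UNIV. emb (e * P i) *s b i) = (\<Sum>i\<in>UNIV. \<sigma> (emb (e * P i) *s b i))"
      using sigma_sum[of UNIV "\<lambda>i. emb (e * P i) *s b i"] e' by auto
    have "\<tau> (emb (e * d)) *s \<sigma> v = \<sigma> (emb (e * d) *s v)"
      using semilinear[OF v, of "e * d"] sum(1) by (simp add: edv tau_emb)
    also have "\<dots> = (\<Sum>i\<in>UNIV. \<tau> (emb (e * P i)) *s \<sigma> (b i))"
      unfolding edv sum(2) using semilinear[OF b e'] by (simp add: tau_emb)
    also have "\<dots> = (\<Sum>i\<in>UNIV. \<tau> (emb (e * d)) *s (\<tau> (v $ i) *s u i))"
      using td by (simp add: P u_def emb_mult isometric_hom_mult[OF t(1)] field_simps)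
    also have "\<dots> = \<tau> (emb (e * d)) *s (A *v vmap \<tau> v)"
      by (simp only: A flip: vec.scale_sum_right)
    finally show ?thesis
      using e(1) d(1) by (simp add: isometric_hom_eq_0[OF t(1)])
  qed
  show ?thesis
    by (intro exI[of _ \<tau>] exI[of _ \<tau>'] exI[of _ c] exI[of _ A] exI[of _ B] conjI allI ballI
        iso c(1) B' B form ext)
qed

end

section \<open>Lattices in the Heisenberg group\<close>

lemma finite_poly_degree_le: "finite {P :: 'a::{finite,zero} poly. degree P \<le> n}"
proof -
  have "P \<in> Poly ` {xs. set xs \<subseteq> UNIV \<and> length xs \<le> Suc n}" if "degree P \<le> n" for P :: "'a poly"
    by (rule image_eqI[of _ _ "coeffs P"], simp) (cases "P = 0"; use that in \<open>simp add: length_coeffs_degree\<close>)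
  hence "{P :: 'a poly. degree P \<le> n} \<subseteq> Poly ` {xs. set xs \<subseteq> UNIV \<and> length xs \<le> Suc n}" by blast
  moreover have "finite {xs :: 'a list. set xs \<subseteq> UNIV \<and> length xs \<le> Suc n}"
    by (rule finite_lists_length_le) simp
  ultimately show ?thesis by (rule finite_subset[OF _ finite_imageI])
qed

context integral_symplectic
begin

definition hmul :: "('a fls ^ 'n) \<times> 'a fls \<Rightarrow> ('a fls ^ 'n) \<times> 'a fls \<Rightarrow> ('a fls ^ 'n) \<times> 'a fls" where
  "hmul x y = (fst x + fst y, snd x + snd y + \<omega> (fst x) (fst y))"

definition hdiv :: "('a fls ^ 'n) \<times> 'a fls \<Rightarrow> ('a fls ^ 'n) \<times> 'a fls \<Rightarrow> ('a fls ^ 'n) \<times> 'a fls" where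
  "hdiv x y = (fst x - fst y, snd x - snd y - \<omega> (fst x) (fst y))"

lemma hdiv_cancel: "hdiv (hdiv x r) (hdiv y r) = hdiv x y"
  by (simp add: hdiv_def diff_left diff_right antisym[of "fst y" "fst r"])

lemma hmul_hdiv: "hmul (hdiv x y) y = x"
  by (simp add: hdiv_def hmul_def diff_left)

lemma hdiv_hmul: "hdiv (hmul x y) y = x"
  by (simp add: hdiv_def hmul_def add_left)

lemma hdiv_inverse: "hdiv x (hdiv (0, 0) y) = hmul x y"
  by (simp add: hdiv_def hmul_def minus_right)

text \<open>
The subgroup criterion in terms of division \<open>x y\<^sup>-\<^sup>1\<close>, the
operation by which finite index is expressed.
\<close>

definition hsubgroup :: "(('a fls ^ 'n) \<times> 'a fls) set \<Rightarrow> bool" where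
  "hsubgroup A \<longleftrightarrow> (0, 0) \<in> A \<and> (\<forall>x\<in>A. \<forall>y\<in>A. hdiv x y \<in> A)"

lemma hsubgroupD:
  assumes "hsubgroup A"
  shows "(0, 0) \<in> A" "x \<in> A \<Longrightarrow> y \<in> A \<Longrightarrow> hdiv x y \<in> A" "x \<in> A \<Longrightarrow> y \<in> A \<Longrightarrow> hmul x y \<in> A"
  using assms unfolding hsubgroup_def hdiv_inverse[symmetric] by blast+

abbreviation integral_points :: "(('a fls ^ 'n) \<times> 'a fls) set" where
  "integral_points \<equiv> F_minus_vec \<times> F_minus"

definition lattice :: "(('a fls ^ 'n) \<times> 'a fls) set \<Rightarrow> bool" where
  "lattice N \<longleftrightarrow> hsubgroup N \<and> N \<subseteq> integral_points \<and> fin_quot hdiv N integral_points"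

lemma latticeD:
  assumes "lattice N"
  shows "hsubgroup N" "N \<subseteq> integral_points" "fin_quot hdiv N integral_points"
  using assms by (simp_all add: lattice_def)

lemma zero_F_minus: "0 \<in> F_minus" "0 \<in> F_minus_vec"
  using add_subgroupD(1)[OF add_subgroup_F_minus] add_subgroupD(1)[OF add_subgroup_F_minus_vec] .

lemma fin_quot_projection:
  assumes "lattice N"
  shows "fin_quot (-) (fst ` N) F_minus_vec"
  by (rule fin_quot_preimage[OF latticeD(3)[OF assms], where g = "\<lambda>v. (v, 0)"])
     (force simp: hdiv_def zero_F_minus)+

lemma lattice_nondegenerate:
  assumes "lattice N" "\<And>w z. (w, z) \<in> N \<Longrightarrow> \<omega> u w = 0"
  shows "u = 0"
proof (rule ccontr)
  assume "u \<noteq> 0"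
  then obtain w where "w \<in> fst ` N" "\<omega> u w \<noteq> 0"
    by (rule exists_nonorthogonal[OF fin_quot_projection[OF assms(1)]])
  thus False using assms(2) by force
qed

text \<open>
For a lattice this is indeed its centre, by \<open>lattice_nondegenerate\<close>.
\<close>

definition centre :: "(('a fls ^ 'n) \<times> 'a fls) set \<Rightarrow> 'a fls set" where
  "centre N = {z. (0, z) \<in> N}"

lemma centre_subgroup:
  assumes "lattice N"
  shows "add_subgroup (centre N)"
  using hsubgroupD[OF latticeD(1)[OF assms]] by (force simp: add_subgroup_def centre_def hdiv_def)

lemma fin_quot_centre:
  assumes "lattice N"
  shows "fin_quot (-) (centre N) F_minus"
  by (rule fin_quot_preimage[OF latticeD(3)[OF assms], where g = "\<lambda>z. (0, z)"])
     (simp_all add: hdiv_def zero_F_minus centre_def)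

lemma centre_mult_iff:
  assumes "lattice N" "a \<in> centre N"
  shows "(v, a + b) \<in> N \<longleftrightarrow> (v, b) \<in> N"
proof -
  have eq: "hmul (0, a) (v, b) = (v, a + b)" "hdiv (0, 0) (0, a) = (0, - a)"
    "hmul (0, - a) (v, a + b) = (v, b)"
    by (simp_all add: hmul_def hdiv_def)
  have a: "(0, a) \<in> N" using assms by (simp add: centre_def)
  note N = hsubgroupD[OF latticeD(1)[OF assms(1)]]
  have "(0, - a) \<in> N" using N(2)[OF N(1) a] by (simp add: eq)
  thus ?thesis using N(3)[of "(0, - a)" "(v, a + b)"] N(3)[OF a, of "(v, b)"] by (auto simp: eq)
qed

text \<open>
Each \<open>v\<close> in the projection of \<open>N\<close> to \<open>F\<^sup>n\<close> determines a coset of \<open>centre N\<close>, the set of all \<open>z\<close> with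
\<open>(v, z) \<in> N\<close>. Because commutators are central, this is a homomorphism, and the set defined here is
its kernel. The box \<open>kernel N \<times> centre N\<close> is then contained in \<open>N\<close>.
\<close>

definition kernel :: "(('a fls ^ 'n) \<times> 'a fls) set \<Rightarrow> ('a fls ^ 'n) set" where
  "kernel N = {v. (v, 0) \<in> N}"

lemma kernel_in: "lattice N \<Longrightarrow> kernel N \<subseteq> F_minus_vec"
  using latticeD(2) by (force simp: kernel_def)

end

locale odd_symplectic = integral_symplectic \<omega>
  for \<omega> :: "'a::{field,finite} fls ^ 'n \<Rightarrow> 'a fls ^ 'n \<Rightarrow> 'a fls" +
  fixes p :: nat
  assumes p: "prime p" "p > 2" and char: "of_nat p = (0 :: 'a fls)"
begin

lemma odd_p: "odd p"
  using p prime_odd_nat by auto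

lemma two_nonzero: "(2 :: 'a fls) \<noteq> 0"
proof
  assume two: "(2 :: 'a fls) = 0"
  obtain k where "p = 2 * k + 1" using odd_p by (rule oddE)
  hence "of_nat p = (2 * of_nat k + 1 :: 'a fls)" by simp
  thus False using two char by simp
qed

lemma add_subgroup_of_nat_mult:
  fixes A :: "'a fls set"
  assumes "add_subgroup A" "x \<in> A"
  shows "of_nat k * x \<in> A"
  by (induction k) (use add_subgroupD[OF assms(1)] assms(2) in \<open>simp_all add: distrib_right\<close>)

text \<open>
The commutator of two elements is \<open>(0, 2 * \<omega> v w)\<close>, and 2 is invertible modulo \<open>p\<close>.
\<close>

lemma omega_in_centre:
  assumes N: "lattice N" and "(v, z) \<in> N" "(w, y) \<in> N"
  shows "\<omega> v w \<in> centre N"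
proof -
  note S = hsubgroupD[OF latticeD(1)[OF N]]
  have "hdiv (hmul (v, z) (w, y)) (hmul (w, y) (v, z)) = (0, 2 * \<omega> v w)"
    by (simp add: hdiv_def hmul_def add_left add_right antisym[of w v] add.commute)
  hence 2: "2 * \<omega> v w \<in> centre N" using S assms(2,3) by (metis centre_def mem_Collect_eq)
  obtain k where k: "p = 2 * k + 1" using odd_p by (rule oddE)
  have "of_nat (Suc k) * (2 * \<omega> v w) = (of_nat p + 1) * \<omega> v w"
    by (simp add: k algebra_simps)
  hence "of_nat (Suc k) * (2 * \<omega> v w) = \<omega> v w" by (simp add: char)
  thus ?thesis using add_subgroup_of_nat_mult[OF centre_subgroup[OF N] 2, of "Suc k"] by metis
qed

lemma kernel_subgroup:
  assumes N: "lattice N"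
  shows "add_subgroup (kernel N)"
  unfolding add_subgroup_def
proof (intro conjI ballI)
  note S = hsubgroupD[OF latticeD(1)[OF N]]
  show "0 \<in> kernel N" using S(1) by (simp add: kernel_def)
  fix v w assume vw: "v \<in> kernel N" "w \<in> kernel N"
  hence "hdiv (v, 0) (w, 0) \<in> N" by (intro S(2)) (simp_all add: kernel_def)
  hence "(v - w, - \<omega> v w) \<in> N" by (simp add: hdiv_def)
  moreover have "\<omega> v w \<in> centre N" using vw by (auto simp: kernel_def intro: omega_in_centre[OF N])
  ultimately show "v - w \<in> kernel N"
    using centre_mult_iff[OF N, of "\<omega> v w" "v - w" "- \<omega> v w"] by (simp add: kernel_def)
qed

lemma omega_kernel_in_centre:
  assumes "lattice N" "v \<in> kernel N" "w \<in> kernel N"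
  shows "\<omega> v w \<in> centre N"
  using assms by (auto simp: kernel_def intro: omega_in_centre)

text \<open>
The homomorphism described at \<open>kernel\<close> has a finite image, since it takes values in the integral
points modulo \<open>centre N\<close>.
\<close>

lemma fin_quot_kernel:
  assumes N: "lattice N"
  shows "fin_quot (-) (kernel N) F_minus_vec"
proof (rule fin_quot_trans[of "(-)"])
  show "fin_quot (-) (fst ` N) F_minus_vec" by (rule fin_quot_projection[OF N])
  define s where "s v = (SOME z. (v, z) \<in> N)" for v
  have s: "(v, s v) \<in> N" if "v \<in> fst ` N" for v
    unfolding s_def using that by (auto intro: someI)
  show "fin_quot (-) (kernel N) (fst ` N)"
  proof (rule fin_quot_preimage[OF fin_quot_centre[OF N], where g = s])
    show "s v \<in> F_minus" if "v \<in> fst ` N" for v using s[OF that] latticeD(2)[OF N] by auto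
    fix v w assume vw: "v \<in> fst ` N" "w \<in> fst ` N" and "s v - s w \<in> centre N"
    hence c: "s v - s w - \<omega> v w \<in> centre N"
      using add_subgroupD(2)[OF centre_subgroup[OF N]] omega_in_centre[OF N s s] by blast
    have "hdiv (v, s v) (w, s w) \<in> N" by (rule hsubgroupD(2)[OF latticeD(1)[OF N] s[OF vw(1)] s[OF vw(2)]])
    hence "(v - w, s v - s w - \<omega> v w + 0) \<in> N" by (simp add: hdiv_def)
    hence "(v - w, 0) \<in> N" unfolding centre_mult_iff[OF N c] .
    thus "v - w \<in> kernel N" by (simp add: kernel_def)
  qed
qed simp

lemma box_in_lattice:
  assumes "lattice N" "v \<in> kernel N" "z \<in> centre N"
  shows "(v, z) \<in> N"
  using centre_mult_iff[OF assms(1,3), of v 0] assms(2) by (simp add: kernel_def)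

lemma centre_of_kernel:
  assumes N: "lattice N" and "(v, z) \<in> N" "v \<in> kernel N"
  shows "z \<in> centre N"
proof -
  have "hdiv (v, z) (v, 0) \<in> N"
    using assms by (intro hsubgroupD(2)[OF latticeD(1)[OF N]]) (simp_all add: kernel_def)
  thus ?thesis by (simp add: hdiv_def centre_def)
qed

lemma box_hsubgroup:
  assumes M: "add_subgroup M" and Z: "add_subgroup Z" and MZ: "\<And>v w. v \<in> M \<Longrightarrow> w \<in> M \<Longrightarrow> \<omega> v w \<in> Z"
  shows "hsubgroup (M \<times> Z)"
  using add_subgroupD(1,2)[OF M] add_subgroupD(1,2)[OF Z] MZ by (auto simp: hsubgroup_def hdiv_def)

text \<open>
The cocycle \<open>\<omega>\<close> need not map \<open>F_minus_vec \<times> M\<close> into \<open>Z\<close>, so the cosets of the two factors do not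
simply combine. Two vectors in the same coset of \<open>M\<close> are written with a common representative
\<open>r v\<close>; the correction \<open>h\<close> of the central coordinate removes the mixed terms \<open>\<omega> (v - r v) (r v)\<close>.
\<close>

lemma fin_quot_box:
  assumes M: "add_subgroup M" "M \<subseteq> F_minus_vec" "fin_quot (-) M F_minus_vec"
    and Z: "add_subgroup Z" "fin_quot (-) Z F_minus"
    and MZ: "\<And>v w. v \<in> M \<Longrightarrow> w \<in> M \<Longrightarrow> \<omega> v w \<in> Z"
  shows "fin_quot hdiv (M \<times> Z) integral_points"
proof -
  obtain \<kappa> :: "_ \<Rightarrow> nat" where fin: "finite (\<kappa> ` F_minus_vec)"
    and sep: "\<And>x y. x \<in> F_minus_vec \<Longrightarrow> y \<in> F_minus_vec \<Longrightarrow> \<kappa> x = \<kappa> y \<Longrightarrow> x - y \<in> M"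
    using M(3) unfolding fin_quot_def by blast
  obtain \<kappa>' :: "_ \<Rightarrow> nat" where fin': "finite (\<kappa>' ` F_minus)"
    and sep': "\<And>x y. x \<in> F_minus \<Longrightarrow> y \<in> F_minus \<Longrightarrow> \<kappa>' x = \<kappa>' y \<Longrightarrow> x - y \<in> Z"
    using Z(2) unfolding fin_quot_def by blast
  define r where "r v = inv_into F_minus_vec \<kappa> (\<kappa> v)" for v
  have r: "r v \<in> F_minus_vec" "v - r v \<in> M" if "v \<in> F_minus_vec" for v
    unfolding r_def using that by (auto intro!: sep simp: f_inv_into_f inv_into_into)
  define h where "h x = snd x - \<omega> (fst x - r (fst x)) (r (fst x))" for x
  have h: "h x \<in> F_minus" if "x \<in> integral_points" for x
    unfolding h_def using that r[of "fst x"] M(2)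
    by (intro add_subgroupD(2)[OF add_subgroup_F_minus] integral) auto
  show ?thesis
  proof (rule fin_quotI[of "\<lambda>x. (\<kappa> (fst x), \<kappa>' (h x))"])
    show "finite ((\<lambda>x. (\<kappa> (fst x), \<kappa>' (h x))) ` integral_points)"
      by (rule finite_subset[OF _ finite_cartesian_product[OF fin fin']]) (use h in auto)
    fix x y assume xy: "x \<in> integral_points" "y \<in> integral_points"
      and eq: "(\<kappa> (fst x), \<kappa>' (h x)) = (\<kappa> (fst y), \<kappa>' (h y))"
    obtain v z w u where x: "x = (v, z)" and y: "y = (w, u)" by (metis surj_pair)
    have vw: "v \<in> F_minus_vec" "w \<in> F_minus_vec" using xy by (simp_all add: x y)
    have rr: "r w = r v" using eq by (simp add: r_def x y)
    have 1: "v - w \<in> M" using eq vw by (intro sep) (simp_all add: x y)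
    have "h x - h y \<in> Z" using eq xy by (intro sep' h) simp_all
    moreover have "\<omega> (v - r v) (w - r v) \<in> Z" using r[OF vw(1)] r[OF vw(2)] by (intro MZ) (simp_all add: rr)
    ultimately have "h x - h y - \<omega> (v - r v) (w - r v) \<in> Z" by (rule add_subgroupD(2)[OF Z(1)])
    also have "h x - h y - \<omega> (v - r v) (w - r v) = z - u - \<omega> v w"
      by (simp add: h_def x y rr diff_left diff_right antisym[of "r v" w])
    finally show "hdiv x y \<in> M \<times> Z" using 1 by (simp add: hdiv_def x y)
  qed
qed

end

section \<open>Isomorphisms between lattices\<close>

locale lattice_isomorphism = odd_symplectic \<omega> p
  for \<omega> :: "'a::{field,finite} fls ^ 'n \<Rightarrow> 'a fls ^ 'n \<Rightarrow> 'a fls" and p +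
  fixes N1 N2 :: "(('a fls ^ 'n) \<times> 'a fls) set" and \<phi>
  assumes N1: "lattice N1" and N2: "lattice N2"
    and phi_bij: "bij_betw \<phi> N1 N2"
    and phi_hmul: "x \<in> N1 \<Longrightarrow> y \<in> N1 \<Longrightarrow> \<phi> (hmul x y) = hmul (\<phi> x) (\<phi> y)"
begin

lemma phi_in: "x \<in> N1 \<Longrightarrow> \<phi> x \<in> N2"
  using phi_bij by (auto simp: bij_betw_def)

lemma phi_surj: "y \<in> N2 \<Longrightarrow> \<exists>x\<in>N1. \<phi> x = y"
  using phi_bij by (auto simp: bij_betw_def)

lemma phi_inj: "x \<in> N1 \<Longrightarrow> y \<in> N1 \<Longrightarrow> \<phi> x = \<phi> y \<longleftrightarrow> x = y"
  using phi_bij by (auto simp: bij_betw_def inj_on_def)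

lemma phi_hdiv:
  assumes "x \<in> N1" "y \<in> N1"
  shows "\<phi> (hdiv x y) = hdiv (\<phi> x) (\<phi> y)"
proof -
  have "hdiv x y \<in> N1" by (rule hsubgroupD(2)[OF latticeD(1)[OF N1] assms])
  from phi_hmul[OF this assms(2)] show ?thesis by (simp add: hmul_hdiv hdiv_hmul)
qed

definition \<zeta> :: "'a fls \<Rightarrow> 'a fls" where "\<zeta> z = snd (\<phi> (0, z))"
definition \<sigma> :: "'a fls ^ 'n \<Rightarrow> 'a fls ^ 'n" where "\<sigma> v = fst (\<phi> (v, 0))"
definition \<eta> :: "'a fls ^ 'n \<Rightarrow> 'a fls" where "\<eta> v = snd (\<phi> (v, 0))"

text \<open>
An isomorphism preserves the property of commuting with all elements, and in \<open>N2\<close> that property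
forces the \<open>F\<^sup>n\<close>-component to vanish.
\<close>

lemma phi_centre:
  assumes z: "z \<in> centre N1"
  shows "\<phi> (0, z) = (0, \<zeta> z)"
proof -
  have z': "(0, z) \<in> N1" using z by (simp add: centre_def)
  let ?u = "fst (\<phi> (0, z))"
  have "?u = 0"
  proof (rule lattice_nondegenerate[OF N2])
    fix w y assume "(w, y) \<in> N2"
    then obtain x where x: "x \<in> N1" "\<phi> x = (w, y)" using phi_surj by blast
    have "hmul (0, z) x = hmul x (0, z)" by (simp add: hmul_def add.commute)
    hence "hmul (\<phi> (0, z)) (w, y) = hmul (w, y) (\<phi> (0, z))"
      using phi_hmul[OF z' x(1)] phi_hmul[OF x(1) z'] x(2) by simp
    hence "\<omega> ?u w = \<omega> w ?u" by (simp add: hmul_def)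
    hence "2 * \<omega> ?u w = 0" using antisym[of w ?u] by (simp add: eq_neg_iff_add_eq_0 flip: mult_2)
    thus "\<omega> ?u w = 0" using two_nonzero by simp
  qed
  thus ?thesis by (simp add: \<zeta>_def prod_eq_iff)
qed

lemma zeta_diff:
  assumes "z \<in> centre N1" "y \<in> centre N1"
  shows "\<zeta> (z - y) = \<zeta> z - \<zeta> y"
proof -
  have "z - y \<in> centre N1" by (rule add_subgroupD(2)[OF centre_subgroup[OF N1] assms])
  moreover have "hdiv (0, z) (0, y) = (0, z - y)" by (simp add: hdiv_def)
  ultimately have "(0, \<zeta> (z - y)) = hdiv (0, \<zeta> z) (0, \<zeta> y)"
    using phi_hdiv[of "(0, z)" "(0, y)"] assms phi_centre by (simp add: centre_def)
  thus ?thesis by (simp add: hdiv_def)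
qed

lemma zeta_inj:
  assumes "z \<in> centre N1" "y \<in> centre N1"
  shows "\<zeta> z = \<zeta> y \<longleftrightarrow> z = y"
  using phi_inj[of "(0, z)" "(0, y)"] assms phi_centre by (simp add: centre_def)

lemma phi_box:
  assumes "v \<in> kernel N1" "z \<in> centre N1"
  shows "\<phi> (v, z) = (\<sigma> v, \<zeta> z + \<eta> v)"
proof -
  have "hmul (0, z) (v, 0) = (v, z)" by (simp add: hmul_def)
  moreover have "\<phi> (hmul (0, z) (v, 0)) = hmul (0, \<zeta> z) (\<sigma> v, \<eta> v)"
    using assms phi_centre[OF assms(2)]
    by (subst phi_hmul) (simp_all add: centre_def kernel_def \<sigma>_def \<eta>_def)
  ultimately show ?thesis by (simp add: hmul_def)
qed

lemma sigma_eta_add: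
  assumes "v \<in> kernel N1" "w \<in> kernel N1"
  shows "\<sigma> (v + w) = \<sigma> v + \<sigma> w"
    and "\<zeta> (\<omega> v w) + \<eta> (v + w) = \<eta> v + \<eta> w + \<omega> (\<sigma> v) (\<sigma> w)"
proof -
  have c: "\<omega> v w \<in> centre N1" by (rule omega_kernel_in_centre[OF N1 assms])
  have s: "v + w \<in> kernel N1" by (rule add_subgroupD(4)[OF kernel_subgroup[OF N1] assms])
  have "hmul (v, 0) (w, 0) = (v + w, \<omega> v w)" by (simp add: hmul_def)
  hence "(\<sigma> (v + w), \<zeta> (\<omega> v w) + \<eta> (v + w)) = hmul (\<sigma> v, \<eta> v) (\<sigma> w, \<eta> w)"
    using phi_hmul[of "(v, 0)" "(w, 0)"] phi_box[OF s c] assms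
    by (simp add: kernel_def \<sigma>_def \<eta>_def)
  thus "\<sigma> (v + w) = \<sigma> v + \<sigma> w"
    "\<zeta> (\<omega> v w) + \<eta> (v + w) = \<eta> v + \<eta> w + \<omega> (\<sigma> v) (\<sigma> w)"
    by (simp_all add: hmul_def)
qed

text \<open>
In the law for \<open>\<eta> (v + w)\<close> the terms \<open>\<zeta> (\<omega> v w)\<close> and \<open>\<omega> (\<sigma> v) (\<sigma> w)\<close> are antisymmetric while the
others are symmetric in \<open>v\<close> and \<open>w\<close>; so the two antisymmetric terms agree and \<open>\<eta>\<close> is additive.
\<close>

lemma zeta_omega:
  assumes "v \<in> kernel N1" "w \<in> kernel N1"
  shows "\<zeta> (\<omega> v w) = \<omega> (\<sigma> v) (\<sigma> w)"
proof -
  have c: "\<omega> v w \<in> centre N1" by (rule omega_kernel_in_centre[OF N1 assms])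
  have 0: "0 \<in> centre N1" by (rule add_subgroupD(1)[OF centre_subgroup[OF N1]])
  have "\<zeta> 0 = 0" using zeta_diff[OF 0 0] by simp
  hence neg: "\<zeta> (\<omega> w v) = - \<zeta> (\<omega> v w)" using zeta_diff[OF 0 c] antisym[of w v] by simp
  let ?x = "\<zeta> (\<omega> v w)" and ?y = "\<omega> (\<sigma> v) (\<sigma> w)" and ?r = "\<eta> v + \<eta> w - \<eta> (v + w)"
  have 1: "?x + \<eta> (v + w) = \<eta> v + \<eta> w + ?y" by (rule sigma_eta_add(2)[OF assms])
  have 2: "- ?x + \<eta> (v + w) = \<eta> v + \<eta> w - ?y"
    using sigma_eta_add(2)[OF assms(2,1)] antisym[of "\<sigma> w" "\<sigma> v"]
    by (simp add: neg add.commute[of w v] add.commute[of "\<eta> w" "\<eta> v"])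
  have "2 * (?x - ?y) = (?x + \<eta> (v + w) - ?y) - (- ?x + \<eta> (v + w) + ?y)"
    by (simp add: algebra_simps)
  also have "\<dots> = 0" unfolding 1 2 by simp
  finally show ?thesis using two_nonzero by simp
qed

lemma eta_add:
  assumes "v \<in> kernel N1" "w \<in> kernel N1"
  shows "\<eta> (v + w) = \<eta> v + \<eta> w"
  using sigma_eta_add(2)[OF assms] zeta_omega[OF assms] by simp

lemma sigma_0: "\<sigma> 0 = 0"
proof -
  have "0 \<in> kernel N1" by (rule add_subgroupD(1)[OF kernel_subgroup[OF N1]])
  from sigma_eta_add(1)[OF this this] show ?thesis by simp
qed

lemma sigma_diff:
  assumes "v \<in> kernel N1" "w \<in> kernel N1"
  shows "\<sigma> (v - w) = \<sigma> v - \<sigma> w"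
  using sigma_eta_add(1)[OF add_subgroupD(2)[OF kernel_subgroup[OF N1] assms] assms(2)]
  by (simp add: eq_diff_eq)

lemma sigma_inj: "inj_on \<sigma> (kernel N1)"
proof (rule inj_onI)
  fix v w assume vw: "v \<in> kernel N1" "w \<in> kernel N1" "\<sigma> v = \<sigma> w"
  let ?d = "v - w"
  have d: "?d \<in> kernel N1" by (rule add_subgroupD(2)[OF kernel_subgroup[OF N1] vw(1,2)])
  have "\<sigma> ?d = 0" using sigma_diff vw by simp
  hence z: "\<zeta> (\<omega> ?d u) = \<zeta> 0" if "u \<in> kernel N1" for u
    using zeta_omega[OF d that] zeta_omega[OF d d] by simp
  have "\<omega> ?d u = 0" if "u \<in> kernel N1" for u
    using zeta_inj[OF omega_kernel_in_centre[OF N1 d that] add_subgroupD(1)[OF centre_subgroup[OF N1]]]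
      z[OF that] by simp
  moreover have "\<exists>u\<in>kernel N1. \<omega> ?d u \<noteq> 0" if "?d \<noteq> 0"
    by (rule exists_nonorthogonal[OF fin_quot_kernel[OF N1] that]) blast
  ultimately have "?d = 0" by blast
  thus "v = w" by simp
qed

lemma sigma_image_subgroup: "add_subgroup (\<sigma> ` kernel N1)"
  unfolding add_subgroup_def
proof (intro conjI ballI)
  have "0 \<in> kernel N1" by (rule add_subgroupD(1)[OF kernel_subgroup[OF N1]])
  thus "0 \<in> \<sigma> ` kernel N1" using sigma_0 by (metis imageI)
  fix x y assume "x \<in> \<sigma> ` kernel N1" "y \<in> \<sigma> ` kernel N1"
  then obtain v w where "v \<in> kernel N1" "w \<in> kernel N1" "x = \<sigma> v" "y = \<sigma> w" by blast
  thus "x - y \<in> \<sigma> ` kernel N1"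
    using sigma_diff add_subgroupD(2)[OF kernel_subgroup[OF N1]] by (metis imageI)
qed

lemma sigma_image_in: "\<sigma> ` kernel N1 \<subseteq> F_minus_vec"
  using phi_in latticeD(2)[OF N2] by (force simp: kernel_def \<sigma>_def)

text \<open>
Lift \<open>w\<close> to an element \<open>n w\<close> of \<open>N1\<close>. If the lifts of two points lie in the same coset of
\<open>kernel N1\<close>, their quotient lies in the box, where \<open>\<phi>\<close> acts on the first component by \<open>\<sigma>\<close>.
\<close>

lemma fin_quot_sigma_image: "fin_quot (-) (\<sigma> ` kernel N1) F_minus_vec"
proof (rule fin_quot_trans[of "(-)"])
  show "fin_quot (-) (fst ` N2) F_minus_vec" by (rule fin_quot_projection[OF N2])
  define n where "n w = (SOME x. x \<in> N1 \<and> fst (\<phi> x) = w)" for w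
  have n: "n w \<in> N1" "fst (\<phi> (n w)) = w" if "w \<in> fst ` N2" for w
  proof -
    have "\<exists>x. x \<in> N1 \<and> fst (\<phi> x) = w" using that phi_surj by force
    from someI_ex[OF this] show "n w \<in> N1" "fst (\<phi> (n w)) = w" by (simp_all add: n_def)
  qed
  show "fin_quot (-) (\<sigma> ` kernel N1) (fst ` N2)"
  proof (rule fin_quot_preimage[OF fin_quot_kernel[OF N1], where g = "\<lambda>w. fst (n w)"])
    show "fst (n w) \<in> F_minus_vec" if "w \<in> fst ` N2" for w
      using n(1)[OF that] latticeD(2)[OF N1] by auto
    fix x y assume xy: "x \<in> fst ` N2" "y \<in> fst ` N2" and k: "fst (n x) - fst (n y) \<in> kernel N1"
    let ?d = "hdiv (n x) (n y)"
    have d: "?d \<in> N1" by (rule hsubgroupD(2)[OF latticeD(1)[OF N1] n(1)[OF xy(1)] n(1)[OF xy(2)]])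
    have fd: "fst ?d \<in> kernel N1" using k by (simp add: hdiv_def)
    have "snd ?d \<in> centre N1" by (rule centre_of_kernel[OF N1 _ fd]) (use d in simp)
    from phi_box[OF fd this] have "fst (\<phi> ?d) = \<sigma> (fst ?d)" by simp
    moreover have "fst (\<phi> ?d) = x - y"
      using phi_hdiv[OF n(1)[OF xy(1)] n(1)[OF xy(2)]] n(2)[OF xy(1)] n(2)[OF xy(2)]
      by (simp add: hdiv_def)
    ultimately show "x - y \<in> \<sigma> ` kernel N1" using fd by (metis imageI)
  qed
qed simp

lemma correspondence: "symplectic_correspondence \<omega> (kernel N1) (\<sigma> ` kernel N1) \<sigma>"
proof
  show "bij_betw \<sigma> (kernel N1) (\<sigma> ` kernel N1)" using sigma_inj by (simp add: bij_betw_def)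
  show "\<omega> x y = \<omega> x' y' \<longleftrightarrow> \<omega> (\<sigma> x) (\<sigma> y) = \<omega> (\<sigma> x') (\<sigma> y')"
    if "x \<in> kernel N1" "y \<in> kernel N1" "x' \<in> kernel N1" "y' \<in> kernel N1" for x y x' y'
    using zeta_inj[OF omega_kernel_in_centre[OF N1 that(1,2)] omega_kernel_in_centre[OF N1 that(3,4)]]
      zeta_omega that by simp
qed (intro kernel_subgroup[OF N1] kernel_in[OF N1] fin_quot_kernel[OF N1] sigma_image_subgroup
    sigma_image_in fin_quot_sigma_image sigma_eta_add; assumption)+

text \<open>
\<open>Z\<close> contains all values of \<open>\<omega>\<close> on \<open>kernel N1\<close>, in particular \<open>P * Q\<close> for a fixed nonzero value \<open>Q\<close>
and all polynomials \<open>P\<close> with \<open>P v\<close> in \<open>kernel N1\<close>. These \<open>P\<close> have finite index among the polynomials,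
and the multiples of \<open>Q\<close> do as well, there being finitely many remainders over a finite field.
\<close>

lemma fin_quot_semilinear_centre:
  assumes \<tau>: "isometric_hom \<tau>"
    and eq: "\<And>v w. v \<in> kernel N1 \<Longrightarrow> w \<in> kernel N1 \<Longrightarrow> \<zeta> (\<omega> v w) = c * \<tau> (\<omega> v w)"
  defines "Z \<equiv> {z \<in> centre N1. \<zeta> z = c * \<tau> z}"
  shows "add_subgroup Z" "fin_quot (-) Z F_minus"
proof -
  have 0: "0 \<in> centre N1" by (rule add_subgroupD(1)[OF centre_subgroup[OF N1]])
  have "\<zeta> 0 = 0" using zeta_diff[OF 0 0] by simp
  thus "add_subgroup Z"
    using 0 add_subgroupD(2)[OF centre_subgroup[OF N1]]
    by (auto simp: Z_def add_subgroup_def zeta_diff isometric_homD[OF \<tau>] right_diff_distrib)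
  interpret symplectic_correspondence \<omega> "kernel N1" "\<sigma> ` kernel N1" \<sigma> by (rule correspondence)
  obtain v where v: "v \<in> kernel N1" "v \<noteq> 0" using exists_multiplicand[of "{}"] by auto
  obtain w where w: "w \<in> kernel N1" "\<omega> v w \<noteq> 0"
    by (rule exists_nonorthogonal[OF fin_quot_kernel[OF N1] v(2)])
  have vw: "v \<in> F_minus_vec" "w \<in> F_minus_vec" using v w kernel_in[OF N1] by auto
  have "\<omega> v w \<in> F_minus" by (rule integral[OF vw])
  then obtain Q where Q: "\<omega> v w = emb Q" by (auto simp: F_minus_emb)
  have Q0: "Q \<noteq> 0" using w(2) by (auto simp: Q)
  have "fin_quot (-) {P. emb P *s v \<in> kernel N1} UNIV"
  proof (rule fin_quot_preimage[OF fin_quot_kernel[OF N1], where g = "\<lambda>P. emb P *s v"])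
    show "emb P *s v \<in> F_minus_vec" for P by (intro F_minus_vec_scale emb_in vw)
    show "P - P' \<in> {P. emb P *s v \<in> kernel N1}" if "emb P *s v - emb P' *s v \<in> kernel N1" for P P'
      using that by (simp add: emb_diff)
  qed
  then obtain \<kappa> :: "_ \<Rightarrow> nat" where fin: "finite (range \<kappa>)"
    and sep: "\<And>P P'. \<kappa> P = \<kappa> P' \<Longrightarrow> emb (P - P') *s v \<in> kernel N1"
    unfolding fin_quot_def by auto
  define g where "g f = (THE P. f = emb P)" for f :: "'a fls"
  have g: "g (emb P) = P" for P by (simp add: g_def)
  show "fin_quot (-) Z F_minus"
  proof (rule fin_quotI[of "\<lambda>f. (g f mod Q, \<kappa> (g f div Q))"])
    have "P mod Q \<in> {R. degree R \<le> degree Q}" for P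
      using degree_mod_less[OF Q0, of P] by auto
    thus "finite ((\<lambda>f. (g f mod Q, \<kappa> (g f div Q))) ` F_minus)"
      by (intro finite_subset[OF _ finite_cartesian_product[OF finite_poly_degree_le[of "degree Q"] fin]])
        auto
    fix x y assume "x \<in> F_minus" "y \<in> F_minus"
      and eq': "(g x mod Q, \<kappa> (g x div Q)) = (g y mod Q, \<kappa> (g y div Q))"
    then obtain P P' where xy: "x = emb P" "y = emb P'" by (auto simp: F_minus_emb)
    let ?D = "P div Q - P' div Q"
    have D: "emb ?D *s v \<in> kernel N1" using eq' by (intro sep) (simp add: xy g)
    have rem: "P mod Q = P' mod Q" using eq' by (simp add: xy g)
    have "P - P' = (P div Q * Q + P mod Q) - (P' div Q * Q + P' mod Q)"
      by (simp only: div_mult_mod_eq)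
    also have "\<dots> = ?D * Q" unfolding rem left_diff_distrib by (rule add_diff_cancel_right)
    finally have "P - P' = ?D * Q" .
    hence "x - y = \<omega> (emb ?D *s v) w" by (simp only: xy emb_mult scale_left Q flip: emb_diff)
    thus "x - y \<in> Z" using eq[OF D w(1)] omega_kernel_in_centre[OF N1 D w(1)] by (simp add: Z_def)
  qed
qed

text \<open>
The automorphism of the whole group is assembled from the semilinear extension of \<open>\<sigma>\<close>, from \<open>c \<tau>\<close>
in place of \<open>\<zeta>\<close>, and from \<open>e\<close>, the extension of \<open>\<eta>\<close> precomposed with the polynomial part. It agrees
with \<open>\<phi>\<close> where \<open>\<zeta>\<close> is known to coincide with \<open>c \<tau>\<close>.
\<close>

theorem extension:
  "\<exists>\<Phi> \<Psi> G. (\<forall>x y. \<Phi> (hmul x y) = hmul (\<Phi> x) (\<Phi> y)) \<and>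
     (\<forall>x. \<Phi> (\<Psi> x) = x) \<and> (\<forall>x. \<Psi> (\<Phi> x) = x) \<and>
     continuous_on UNIV \<Phi> \<and> continuous_on UNIV \<Psi> \<and>
     G \<subseteq> N1 \<and> hsubgroup G \<and> fin_quot hdiv G integral_points \<and> (\<forall>x\<in>G. \<Phi> x = \<phi> x)"
proof -
  interpret symplectic_correspondence \<omega> "kernel N1" "\<sigma> ` kernel N1" \<sigma> by (rule correspondence)
  obtain \<tau> \<tau>' c A B where iso: "inverse_isometries \<tau> \<tau>'" and c: "c \<noteq> 0"
    and AB: "A ** B = mat 1" "B ** A = mat 1"
    and form: "\<And>x y. \<omega> (A *v vmap \<tau> x) (A *v vmap \<tau> y) = c * \<tau> (\<omega> x y)"
    and ext: "\<And>v. v \<in> kernel N1 \<Longrightarrow> A *v vmap \<tau> v = \<sigma> v"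
    using semilinear_extension by blast
  have \<tau>: "isometric_hom \<tau>" and \<tau>': "isometric_hom \<tau>'"
    and inv: "\<tau> (\<tau>' f) = f" "\<tau>' (\<tau> f) = f" for f
    using iso by (simp_all add: inverse_isometries_def)
  obtain \<eta>' where \<eta>': "\<And>v. v \<in> kernel N1 \<Longrightarrow> \<eta>' v = \<eta> v"
    "\<And>v w. v \<in> F_minus_vec \<Longrightarrow> w \<in> F_minus_vec \<Longrightarrow> \<eta>' (v + w) = \<eta>' v + \<eta>' w"
    using additive_extension[OF p(1) char kernel_subgroup[OF N1] fin_quot_kernel[OF N1] eta_add] by blast
  define s where "s v = A *v vmap \<tau> v" for v
  define s' where "s' v = vmap \<tau>' (B *v v)" for v
  have ss': "s (s' v) = v" for v
  proof -
    have "vmap \<tau> (vmap \<tau>' (B *v v)) = B *v v" by (simp add: vec_eq_iff inv)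
    thus ?thesis by (simp add: s_def s'_def matrix_vector_mul_assoc AB)
  qed
  have s's: "s' (s v) = v" for v
    by (simp add: s_def s'_def matrix_vector_mul_assoc AB vec_eq_iff inv)
  have s_add: "s (v + w) = s v + s w" for v w
    by (simp add: s_def vmap_add[OF \<tau>] matrix_vector_right_distrib)
  have s_cont: "continuous_on S (\<lambda>x. s (f x))" if "continuous_on S f" for S and f :: "('a fls ^ 'n) \<times> 'a fls \<Rightarrow> _"
    unfolding s_def by (intro continuous_on_matrix_vector_mult vmap_continuous[OF \<tau>] that)
  have s'_cont: "continuous_on S (\<lambda>x. s' (f x))" if "continuous_on S f" for S and f :: "('a fls ^ 'n) \<times> 'a fls \<Rightarrow> _"
    unfolding s'_def by (rule vmap_continuous[OF \<tau>'], rule continuous_on_matrix_vector_mult, rule that)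
  define e where "e v = \<eta>' (poly_part_vec v)" for v
  have e_add: "e (v + w) = e v + e w" for v w
    by (simp add: e_def poly_part_vec_add \<eta>'(2) poly_part_vec_in)
  have e_cont: "continuous_on S (\<lambda>x. e (f x))" if "continuous_on S f" for S and f :: "('a fls ^ 'n) \<times> 'a fls \<Rightarrow> _"
  proof -
    have "continuous_on UNIV e" unfolding e_def by (rule continuous_on_poly_part_vec)
    from continuous_on_compose2[OF this that] show ?thesis by simp
  qed
  define \<Phi> where "\<Phi> x = (s (fst x), c * \<tau> (snd x) + e (fst x))" for x
  define \<Psi> where "\<Psi> y = (s' (fst y), \<tau>' (inverse c * (snd y - e (s' (fst y)))))" for y
  define Z where "Z = {z \<in> centre N1. \<zeta> z = c * \<tau> z}"
  have zo: "\<zeta> (\<omega> v w) = c * \<tau> (\<omega> v w)" if "v \<in> kernel N1" "w \<in> kernel N1" for v w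
    using zeta_omega[OF that] form[of v w] ext that by simp
  have Z: "add_subgroup Z" "fin_quot (-) Z F_minus"
    unfolding Z_def by (rule fin_quot_semilinear_centre[OF \<tau> zo]; assumption)+
  have MZ: "\<omega> v w \<in> Z" if "v \<in> kernel N1" "w \<in> kernel N1" for v w
    using zo[OF that] omega_kernel_in_centre[OF N1 that] by (simp add: Z_def)
  have "\<Phi> (hmul x y) = hmul (\<Phi> x) (\<Phi> y)" for x y
  proof -
    have "\<omega> (s (fst x)) (s (fst y)) = c * \<tau> (\<omega> (fst x) (fst y))" unfolding s_def by (rule form)
    thus ?thesis
      by (simp add: \<Phi>_def hmul_def s_add e_add isometric_hom_add[OF \<tau>] distrib_left)
  qed
  moreover have "\<Phi> (\<Psi> x) = x" for x
    using c by (simp add: \<Phi>_def \<Psi>_def ss' inv prod_eq_iff flip: mult.assoc)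
  moreover have "\<Psi> (\<Phi> x) = x" for x
    using c by (simp add: \<Phi>_def \<Psi>_def s's inv prod_eq_iff flip: mult.assoc)
  moreover have "continuous_on UNIV \<Phi>"
    unfolding \<Phi>_def
    by (intro continuous_on_Pair s_cont continuous_on_add continuous_on_fls_mult_left
        isometric_hom_continuous[OF \<tau>] e_cont continuous_on_fst continuous_on_snd continuous_on_id)
  moreover have "continuous_on UNIV \<Psi>"
    unfolding \<Psi>_def
    by (intro continuous_on_Pair s'_cont isometric_hom_continuous[OF \<tau>'] continuous_on_fls_mult_left
        continuous_on_diff e_cont continuous_on_fst continuous_on_snd continuous_on_id)
  moreover have "kernel N1 \<times> Z \<subseteq> N1"
    using box_in_lattice[OF N1] by (auto simp: Z_def)
  moreover have "hsubgroup (kernel N1 \<times> Z)"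
    by (rule box_hsubgroup[OF kernel_subgroup[OF N1] Z(1) MZ])
  moreover have "fin_quot hdiv (kernel N1 \<times> Z) integral_points"
    by (rule fin_quot_box[OF kernel_subgroup[OF N1] kernel_in[OF N1] fin_quot_kernel[OF N1] Z MZ])
  moreover have "\<Phi> x = \<phi> x" if "x \<in> kernel N1 \<times> Z" for x
  proof -
    obtain v z where x: "x = (v, z)" by (metis surj_pair)
    have v: "v \<in> kernel N1" and z: "z \<in> centre N1" "\<zeta> z = c * \<tau> z" using that by (auto simp: x Z_def)
    have "poly_part_vec v = v" using v kernel_in[OF N1] by (intro poly_part_vec_id) auto
    hence "e v = \<eta> v" by (simp add: e_def \<eta>'(1)[OF v])
    thus ?thesis by (simp add: x phi_box[OF v z(1)] z(2) \<Phi>_def s_def ext[OF v])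
  qed
  ultimately show ?thesis
    by (intro exI[of _ \<Phi>] exI[of _ \<Psi>] exI[of _ "kernel N1 \<times> Z"]) blast
qed

end

section \<open>Automorphism rigidity of arithmetic subgroups\<close>

context integral_symplectic
begin

lemma heisenberg_simps [simp]:
  "carrier (heisenberg \<omega>) = UNIV" "\<one>\<^bsub>heisenberg \<omega>\<^esub> = (0, 0)" "x \<otimes>\<^bsub>heisenberg \<omega>\<^esub> y = hmul x y"
  by (simp_all add: heisenberg_def hmul_def case_prod_beta)

lemma heisenberg_group: "group (heisenberg \<omega>)"
proof (rule groupI)
  show "\<exists>y\<in>carrier (heisenberg \<omega>). y \<otimes>\<^bsub>heisenberg \<omega>\<^esub> x = \<one>\<^bsub>heisenberg \<omega>\<^esub>" for x
    by (rule bexI[of _ "hdiv (0, 0) x"]) (simp_all add: hmul_hdiv)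
qed (simp_all add: hmul_def add_left add_right add_ac)

lemma heisenberg_div: "x \<otimes>\<^bsub>heisenberg \<omega>\<^esub> inv\<^bsub>heisenberg \<omega>\<^esub> y = hdiv x y"
proof -
  interpret group "heisenberg \<omega>" by (rule heisenberg_group)
  have "hdiv x y \<otimes>\<^bsub>heisenberg \<omega>\<^esub> y = x" by (simp add: hmul_hdiv)
  thus ?thesis by (metis UNIV_I heisenberg_simps(1) inv_solve_right)
qed

lemma subgroup_heisenberg_iff: "subgroup A (heisenberg \<omega>) \<longleftrightarrow> hsubgroup A"
proof
  interpret group "heisenberg \<omega>" by (rule heisenberg_group)
  show "hsubgroup A" if A: "subgroup A (heisenberg \<omega>)"
    unfolding hsubgroup_def
  proof (intro conjI ballI)
    show "(0, 0) \<in> A" using subgroup.one_closed[OF A] by simp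
    show "hdiv x y \<in> A" if "x \<in> A" "y \<in> A" for x y
      unfolding heisenberg_div[symmetric]
      by (intro subgroup.m_closed[OF A] subgroup.m_inv_closed[OF A] that)
  qed
  show "subgroup A (heisenberg \<omega>)" if A: "hsubgroup A"
  proof (rule subgroupI)
    show "A \<noteq> {}" using hsubgroupD(1)[OF A] by auto
    show "inv\<^bsub>heisenberg \<omega>\<^esub> x \<in> A" if "x \<in> A" for x
    proof -
      have "hdiv (0, 0) x = inv\<^bsub>heisenberg \<omega>\<^esub> x"
        unfolding heisenberg_div[symmetric] using l_one[of "inv\<^bsub>heisenberg \<omega>\<^esub> x"] by simp
      thus ?thesis using hsubgroupD(2)[OF A hsubgroupD(1)[OF A] that] by simp
    qed
    show "x \<otimes>\<^bsub>heisenberg \<omega>\<^esub> y \<in> A" if "x \<in> A" "y \<in> A" for x y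
      using hsubgroupD(3)[OF A that] by simp
  qed simp
qed

lemma finite_index_imp_fin_quot:
  assumes "finite_index_in (heisenberg \<omega>) A B"
  shows "fin_quot hdiv A B"
proof (rule fin_quotI[of "\<lambda>b. A #>\<^bsub>heisenberg \<omega>\<lparr>carrier := B\<rparr>\<^esub> b"])
  have A: "subgroup A (heisenberg \<omega>\<lparr>carrier := B\<rparr>)"
    and fin: "finite (rcosets\<^bsub>heisenberg \<omega>\<lparr>carrier := B\<rparr>\<^esub> A)"
    using assms by (simp_all add: finite_index_in_def)
  show "finite ((\<lambda>b. A #>\<^bsub>heisenberg \<omega>\<lparr>carrier := B\<rparr>\<^esub> b) ` B)"
    by (rule finite_subset[OF _ fin]) (auto simp: RCOSETS_def)
  fix x y assume eq: "A #>\<^bsub>heisenberg \<omega>\<lparr>carrier := B\<rparr>\<^esub> x = A #>\<^bsub>heisenberg \<omega>\<lparr>carrier := B\<rparr>\<^esub> y"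
  have "(0, 0) \<in> A" using subgroup.one_closed[OF A] by simp
  hence "hmul (0, 0) x \<in> A #>\<^bsub>heisenberg \<omega>\<lparr>carrier := B\<rparr>\<^esub> x" by (auto simp: r_coset_def)
  hence "x \<in> A #>\<^bsub>heisenberg \<omega>\<lparr>carrier := B\<rparr>\<^esub> y" unfolding eq by (simp add: hmul_def)
  then obtain a where "a \<in> A" "x = hmul a y" by (auto simp: r_coset_def)
  thus "hdiv x y \<in> A" by (simp add: hdiv_hmul)
qed

lemma fin_quot_imp_finite_index:
  assumes A: "hsubgroup A" and B: "hsubgroup B" and "A \<subseteq> B" and fin: "fin_quot hdiv A B"
  shows "finite_index_in (heisenberg \<omega>) A B"
proof -
  interpret group "heisenberg \<omega>" by (rule heisenberg_group)
  have sub: "subgroup A (heisenberg \<omega>\<lparr>carrier := B\<rparr>)"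
    using A B \<open>A \<subseteq> B\<close> by (intro subgroup_incl) (simp_all add: subgroup_heisenberg_iff)
  let ?c = "\<lambda>b. A #>\<^bsub>heisenberg \<omega>\<lparr>carrier := B\<rparr>\<^esub> b"
  obtain C where C: "finite C" "\<forall>b\<in>B. \<exists>c\<in>C. hdiv b c \<in> A" using fin_quot_reps[OF fin] by blast
  have "?c b \<in> ?c ` C" if "b \<in> B" for b
  proof -
    from bspec[OF C(2) that] obtain r where r: "r \<in> C" "hdiv b r \<in> A" ..
    have "A #>\<^bsub>heisenberg \<omega>\<^esub> hdiv b r = A"
      by (rule coset_join2) (use A r(2) in \<open>simp_all add: subgroup_heisenberg_iff\<close>)
    hence "A #>\<^bsub>heisenberg \<omega>\<^esub> b = A #>\<^bsub>heisenberg \<omega>\<^esub> r"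
      by (intro coset_mult_inv1, unfold heisenberg_div) simp_all
    hence "?c b = ?c r" by (simp only: r_coset_consistent)
    thus ?thesis using imageI[OF r(1), of ?c] by (simp only:)
  qed
  hence "rcosets\<^bsub>heisenberg \<omega>\<lparr>carrier := B\<rparr>\<^esub> A \<subseteq> ?c ` C" by (auto simp: RCOSETS_def)
  hence "finite (rcosets\<^bsub>heisenberg \<omega>\<lparr>carrier := B\<rparr>\<^esub> A)" using C(1) by (rule finite_subset[OF _ finite_imageI])
  thus ?thesis using sub by (simp add: finite_index_in_def)
qed


lemma hsubgroup_integral_points: "hsubgroup integral_points"
  using add_subgroupD(1,2)[OF add_subgroup_F_minus] add_subgroupD(1,2)[OF add_subgroup_F_minus_vec]
    integral by (auto simp: hsubgroup_def hdiv_def)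

lemma fin_quot_hdiv_refl: "hsubgroup A \<Longrightarrow> fin_quot hdiv A A"
  by (rule fin_quotI[of "\<lambda>_. ()"]) (auto intro: hsubgroupD)

lemma hsubgroup_of_finite_index:
  assumes "hsubgroup B" "finite_index_in (heisenberg \<omega>) A B"
  shows "hsubgroup A" "A \<subseteq> B" "fin_quot hdiv A B"
proof -
  have A: "subgroup A (heisenberg \<omega>\<lparr>carrier := B\<rparr>)" using assms(2) by (simp add: finite_index_in_def)
  show "A \<subseteq> B" using subgroup.subset[OF A] by simp
  show "hsubgroup A"
    using group.incl_subgroup[OF heisenberg_group _ A] assms(1) by (simp add: subgroup_heisenberg_iff)
  show "fin_quot hdiv A B" by (rule finite_index_imp_fin_quot[OF assms(2)])
qed

lemma arithmetic_subgroupD: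
  assumes "arithmetic_subgroup \<omega> \<Gamma>"
  shows "hsubgroup \<Gamma>" "fin_quot hdiv (\<Gamma> \<inter> integral_points) \<Gamma>"
    "fin_quot hdiv (\<Gamma> \<inter> integral_points) integral_points"
proof -
  have A: "subgroup \<Gamma> (heisenberg \<omega>)" "commensurable (heisenberg \<omega>) \<Gamma> integral_points"
    using assms by (simp_all add: arithmetic_subgroup_def)
  show "hsubgroup \<Gamma>" using A(1) by (simp only: subgroup_heisenberg_iff)
  show "fin_quot hdiv (\<Gamma> \<inter> integral_points) \<Gamma>"
    using A(2) unfolding commensurable_def by (blast intro: finite_index_imp_fin_quot)
  show "fin_quot hdiv (\<Gamma> \<inter> integral_points) integral_points"
    using A(2) unfolding commensurable_def by (blast intro: finite_index_imp_fin_quot)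
qed

lemma F_minus_small: "f \<in> F_minus \<Longrightarrow> g \<in> F_minus \<Longrightarrow> dist f g < 1 \<Longrightarrow> f = g"
  using poly_part_eqI[of f g] by (simp add: poly_part_id)

text \<open>
The neighbourhood \<open>?B\<close> of \<open>x\<close> meets every coset of \<open>\<Gamma> \<inter> integral_points\<close> in at most one point, as
its diameter is smaller than the least distance between integral points. Hence it contains
finitely many points of \<open>\<Gamma>\<close>, and removing those other than \<open>x\<close> leaves an open set.
\<close>

lemma arithmetic_subgroup_discrete:
  assumes \<Gamma>: "arithmetic_subgroup \<omega> \<Gamma>"
  shows "discrete_subgroup (heisenberg \<omega>) heisenberg_topology \<Gamma>"
proof -
  obtain \<kappa> :: "_ \<Rightarrow> nat" where fin: "finite (\<kappa> ` \<Gamma>)"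
    and sep: "\<And>x y. x \<in> \<Gamma> \<Longrightarrow> y \<in> \<Gamma> \<Longrightarrow> \<kappa> x = \<kappa> y \<Longrightarrow> hdiv x y \<in> \<Gamma> \<inter> integral_points"
    using arithmetic_subgroupD(2)[OF \<Gamma>] unfolding fin_quot_def by blast
  have "openin (top_of_set \<Gamma>) {x}" if x: "x \<in> \<Gamma>" for x
  proof -
    let ?B = "{w. \<forall>i. dist (w $ i) (fst x $ i) < inverse (2 ^ 1)} \<times> ball (snd x) (inverse (2 ^ 1))"
    have close: "f - g \<in> F_minus \<Longrightarrow> f = g" if "dist f c < inverse (2 ^ 1)" "dist g c < inverse (2 ^ 1)"
      for f g c :: "'a fls"
    proof -
      assume "f - g \<in> F_minus"
      moreover have "dist f g < 1" using that dist_triangle2[of f g c] by simp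
      hence "dist (f - g) 0 < 1" using dist_fls_less_iff[of f g 0] dist_fls_less_iff[of "f - g" 0 0] by simp
      ultimately show ?thesis using F_minus_small[of "f - g" 0] zero_F_minus(1) by simp
    qed
    have "inj_on \<kappa> (?B \<inter> \<Gamma>)"
    proof (rule inj_onI)
      fix y z assume yz: "y \<in> ?B \<inter> \<Gamma>" "z \<in> ?B \<inter> \<Gamma>" and "\<kappa> y = \<kappa> z"
      hence d: "hdiv y z \<in> integral_points" using sep[of y z] by blast
      have "fst y $ i = fst z $ i" for i
      proof (rule close)
        show "fst y $ i - fst z $ i \<in> F_minus" using d by (auto simp: hdiv_def F_minus_vec_def)
      qed (use yz in auto)
      hence fst: "fst y = fst z" by (simp add: vec_eq_iff)
      have "snd y = snd z"
      proof (rule close)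
        show "snd y - snd z \<in> F_minus" using d by (auto simp: hdiv_def fst)
      qed (use yz in \<open>auto simp: dist_commute\<close>)
      thus "y = z" using fst by (simp add: prod_eq_iff)
    qed
    moreover have "finite (\<kappa> ` (?B \<inter> \<Gamma>))" by (rule finite_subset[OF _ fin]) auto
    ultimately have finB: "finite (?B \<inter> \<Gamma>)" using finite_imageD by blast
    have "open {w :: 'a fls ^ 'n. \<forall>i. dist (w $ i) (fst x $ i) < inverse (2 ^ 1)}" by (rule open_vec_ball)
    hence "open ?B" by (intro open_Times open_ball)
    hence "open (?B - (?B \<inter> \<Gamma> - {x}))" using finB by (intro open_Diff finite_imp_closed) auto
    from openin_open_Int[OF this, of \<Gamma>]
    have "openin (top_of_set \<Gamma>) (\<Gamma> \<inter> (?B - (?B \<inter> \<Gamma> - {x})))" .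
    also have "\<Gamma> \<inter> (?B - (?B \<inter> \<Gamma> - {x})) = {x}" using x by auto
    finally show ?thesis .
  qed
  hence "subtopology heisenberg_topology \<Gamma> = discrete_topology \<Gamma>"
    using discrete_topology_unique[of \<Gamma> "top_of_set \<Gamma>"] by simp
  thus ?thesis
    using \<Gamma> by (simp add: discrete_subgroup_def arithmetic_subgroup_def)
qed

lemma continuous_hom_virtual_automorphism:
  assumes hom: "\<And>x y. \<Phi> (hmul x y) = hmul (\<Phi> x) (\<Phi> y)"
    and inv: "\<And>x. \<Phi> (\<Psi> x) = x" "\<And>x. \<Psi> (\<Phi> x) = x"
    and cont: "continuous_on UNIV \<Phi>" "continuous_on UNIV \<Psi>"
  shows "virtual_automorphism (heisenberg \<omega>) heisenberg_topology \<Phi> UNIV UNIV"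
  unfolding virtual_automorphism_def
proof (intro conjI)
  have U: "hsubgroup UNIV" by (simp add: hsubgroup_def)
  show "finite_index_in (heisenberg \<omega>) UNIV (carrier (heisenberg \<omega>))"
    using fin_quot_imp_finite_index[OF U U _ fin_quot_hdiv_refl[OF U]] by simp
  thus "finite_index_in (heisenberg \<omega>) UNIV (carrier (heisenberg \<omega>))" .
  have "bij \<Phi>" by (rule bijI') (metis inv)+
  thus "\<Phi> \<in> iso (heisenberg \<omega>\<lparr>carrier := UNIV\<rparr>) (heisenberg \<omega>\<lparr>carrier := UNIV\<rparr>)"
    by (simp add: iso_def hom_def hom)
  have "homeomorphic_maps euclidean euclidean \<Phi> \<Psi>"
    using inv cont by (simp add: homeomorphic_maps_def)
  thus "homeomorphic_map (subtopology heisenberg_topology UNIV) (subtopology heisenberg_topology UNIV) \<Phi>"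
    by (auto simp: homeomorphic_map_maps)
qed simp_all

end

context odd_symplectic
begin

text \<open>
The extension is defined on the whole group; the isomorphism is first restricted to the integral
points of its domain whose images are integral.
\<close>

lemma virtual_automorphism_extends:
  assumes \<Gamma>: "arithmetic_subgroup \<omega> \<Gamma>"
    and va: "virtual_automorphism (heisenberg \<omega>\<lparr>carrier := \<Gamma>\<rparr>) (discrete_topology \<Gamma>) \<phi> \<Gamma>1 \<Gamma>2"
  shows "\<exists>\<Phi> G1 G2 \<Gamma>1'. virtual_automorphism (heisenberg \<omega>) heisenberg_topology \<Phi> G1 G2 \<and>
    finite_index_in (heisenberg \<omega>) \<Gamma>1' \<Gamma>1 \<and> \<Gamma>1' \<subseteq> G1 \<and> (\<forall>x\<in>\<Gamma>1'. \<Phi> x = \<phi> x)"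
proof -
  have "finite_index_in (heisenberg \<omega>) \<Gamma>1 \<Gamma>" "finite_index_in (heisenberg \<omega>) \<Gamma>2 \<Gamma>"
    and iso: "\<phi> \<in> iso (heisenberg \<omega>\<lparr>carrier := \<Gamma>1\<rparr>) (heisenberg \<omega>\<lparr>carrier := \<Gamma>2\<rparr>)"
    using va by (simp_all add: virtual_automorphism_def finite_index_in_def)
  note G = arithmetic_subgroupD[OF \<Gamma>]
  note G1 = hsubgroup_of_finite_index[OF G(1) \<open>finite_index_in (heisenberg \<omega>) \<Gamma>1 \<Gamma>\<close>]
  note G2 = hsubgroup_of_finite_index[OF G(1) \<open>finite_index_in (heisenberg \<omega>) \<Gamma>2 \<Gamma>\<close>]
  note trans = fin_quot_trans[of hdiv, OF hdiv_cancel]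
  have bij: "bij_betw \<phi> \<Gamma>1 \<Gamma>2" and hom: "\<And>x y. x \<in> \<Gamma>1 \<Longrightarrow> y \<in> \<Gamma>1 \<Longrightarrow> \<phi> (hmul x y) = hmul (\<phi> x) (\<phi> y)"
    using iso by (auto simp: iso_def hom_def)
  have phi: "\<phi> x \<in> \<Gamma>2" if "x \<in> \<Gamma>1" for x using bij that by (auto simp: bij_betw_def)
  have phi_div: "\<phi> (hdiv x y) = hdiv (\<phi> x) (\<phi> y)" if "x \<in> \<Gamma>1" "y \<in> \<Gamma>1" for x y
    using hom[OF hsubgroupD(2)[OF G1(1) that] that(2)] by (simp add: hmul_hdiv hdiv_hmul)
  define N1 where "N1 = {x \<in> \<Gamma>1. x \<in> integral_points \<and> \<phi> x \<in> integral_points}"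
  define N2 where "N2 = \<phi> ` N1"
  have N1_sub: "N1 \<subseteq> \<Gamma>1" "N1 \<subseteq> integral_points" and N2_sub: "N2 \<subseteq> \<Gamma>2" "N2 \<subseteq> integral_points"
    using phi unfolding N1_def N2_def by blast+
  \<comment> \<open>by commensurability, finite index in \<open>\<Gamma>\<close> implies finite index in the integral points\<close>
  have lattice: "lattice N" if "hsubgroup N" "N \<subseteq> integral_points" "fin_quot hdiv N \<Delta>" "fin_quot hdiv \<Delta> \<Gamma>" for N \<Delta>
  proof -
    have "fin_quot hdiv N (\<Gamma> \<inter> integral_points)"
      by (rule fin_quot_mono[OF trans[OF that(3,4)]]) auto
    thus ?thesis using trans[OF _ G(3)] that by (simp add: lattice_def)
  qed
  have int: "fin_quot hdiv integral_points \<Delta>" if "\<Delta> \<subseteq> \<Gamma>" for \<Delta>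
    by (rule fin_quot_mono[OF G(2) that]) auto
  note I = hsubgroupD[OF hsubgroup_integral_points]
  have N1_hsub: "hsubgroup N1"
    unfolding hsubgroup_def
  proof (intro conjI ballI)
    have "\<phi> (0, 0) = (0, 0)"
      using phi_div[OF hsubgroupD(1)[OF G1(1)] hsubgroupD(1)[OF G1(1)]] by (simp add: hdiv_def)
    thus "(0, 0) \<in> N1" using hsubgroupD(1)[OF G1(1)] I(1) by (simp add: N1_def)
    fix x y assume "x \<in> N1" "y \<in> N1"
    hence "x \<in> \<Gamma>1" "y \<in> \<Gamma>1" "x \<in> integral_points" "y \<in> integral_points"
      "\<phi> x \<in> integral_points" "\<phi> y \<in> integral_points" by (auto simp only: N1_def mem_Collect_eq)
    thus "hdiv x y \<in> N1"
      unfolding N1_def using hsubgroupD(2)[OF G1(1)] I(2) phi_div by (metis (mono_tags, lifting) mem_Collect_eq)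
  qed
  have N1_fin: "fin_quot hdiv N1 \<Gamma>1"
  proof -
    have "fin_quot hdiv {x. \<phi> x \<in> integral_points} \<Gamma>1"
      by (rule fin_quot_preimage[OF int[OF G2(2)], where g = \<phi>]) (use phi phi_div in auto)
    hence "fin_quot hdiv (\<Gamma>1 \<inter> (integral_points \<inter> {x. \<phi> x \<in> integral_points})) \<Gamma>1"
      by (intro fin_quot_Int fin_quot_hdiv_refl G1(1) int G1(2))
    thus ?thesis by (rule fin_quot_mono) (auto simp: N1_def)
  qed
  have N1: "lattice N1" by (rule lattice[OF N1_hsub N1_sub(2) N1_fin G1(3)])
  have N2_hsub: "hsubgroup N2"
    unfolding hsubgroup_def
  proof (intro conjI ballI)
    have "\<phi> (0, 0) = (0, 0)"
      using phi_div[OF hsubgroupD(1)[OF G1(1)] hsubgroupD(1)[OF G1(1)]] by (simp add: hdiv_def)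
    thus "(0, 0) \<in> N2" using hsubgroupD(1)[OF N1_hsub] unfolding N2_def by (metis imageI)
    fix x y assume "x \<in> N2" "y \<in> N2"
    then obtain a b where "a \<in> N1" "b \<in> N1" "x = \<phi> a" "y = \<phi> b" unfolding N2_def by blast
    thus "hdiv x y \<in> N2"
      using phi_div[of a b] N1_sub(1) hsubgroupD(2)[OF N1_hsub, of a b] unfolding N2_def
      by (metis imageI subsetD)
  qed
  have N2_fin: "fin_quot hdiv N2 \<Gamma>2"
  proof (rule fin_quot_preimage[OF N1_fin, where g = "inv_into \<Gamma>1 \<phi>"])
    have inv: "inv_into \<Gamma>1 \<phi> x \<in> \<Gamma>1" "\<phi> (inv_into \<Gamma>1 \<phi> x) = x" if "x \<in> \<Gamma>2" for x
      using bij that by (auto simp: bij_betw_def inv_into_into f_inv_into_f)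
    show "inv_into \<Gamma>1 \<phi> x \<in> \<Gamma>1" if "x \<in> \<Gamma>2" for x using inv that by simp
    show "hdiv x y \<in> N2" if "x \<in> \<Gamma>2" "y \<in> \<Gamma>2" "hdiv (inv_into \<Gamma>1 \<phi> x) (inv_into \<Gamma>1 \<phi> y) \<in> N1" for x y
      using imageI[OF that(3), of \<phi>] phi_div[OF inv(1)[OF that(1)] inv(1)[OF that(2)]] inv(2) that
      by (simp add: N2_def)
  qed
  have N2: "lattice N2" by (rule lattice[OF N2_hsub N2_sub(2) N2_fin G2(3)])
  interpret lattice_isomorphism \<omega> p N1 N2 \<phi>
  proof
    show "bij_betw \<phi> N1 N2"
      using bij N1_sub(1) unfolding N2_def bij_betw_def by (auto intro: inj_on_subset)
    show "\<phi> (hmul x y) = hmul (\<phi> x) (\<phi> y)" if "x \<in> N1" "y \<in> N1" for x y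
      using hom that N1_sub(1) by blast
  qed (rule N1 N2)+
  obtain \<Phi> \<Psi> G where ext: "\<forall>x y. \<Phi> (hmul x y) = hmul (\<Phi> x) (\<Phi> y)"
    "\<forall>x. \<Phi> (\<Psi> x) = x" "\<forall>x. \<Psi> (\<Phi> x) = x" "continuous_on UNIV \<Phi>" "continuous_on UNIV \<Psi>"
    and G': "G \<subseteq> N1" "hsubgroup G" "fin_quot hdiv G integral_points" "\<forall>x\<in>G. \<Phi> x = \<phi> x"
    using extension by blast
  have "fin_quot hdiv G N1" by (rule fin_quot_mono[OF G'(3) N1_sub(2)]) simp
  hence "fin_quot hdiv G \<Gamma>1" by (rule trans[OF _ N1_fin])
  hence "finite_index_in (heisenberg \<omega>) G \<Gamma>1"
    using G' N1_sub(1) by (intro fin_quot_imp_finite_index G1(1)) auto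
  moreover have "virtual_automorphism (heisenberg \<omega>) heisenberg_topology \<Phi> UNIV UNIV"
    by (rule continuous_hom_virtual_automorphism[of \<Phi> \<Psi>]) (use ext in auto)
  ultimately show ?thesis using G'(4) by blast
qed

end

lemma of_nat_card_eq_0: "of_nat CARD('a::{ring_1,finite}) = (0 :: 'a)"
proof -
  have "(\<Sum>x\<in>UNIV. x + 1) = (\<Sum>x\<in>UNIV. x :: 'a)"
    by (rule sum.reindex_bij_witness[of _ "\<lambda>x. x - 1" "\<lambda>x. x + 1"]) auto
  thus ?thesis by (simp add: sum.distrib)
qed

theorem corollary1p16:
  fixes \<omega> :: "('a::{field,finite}) fls ^ 'n \<Rightarrow> 'a fls ^ 'n \<Rightarrow> 'a fls"
    and \<Gamma> :: "(('a fls ^ 'n) \<times> 'a fls) set"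
    and p k m :: nat
  assumes "prime p" and "p > 2"
    and "CARD('a) = p ^ k"
    and "m \<ge> 1" and "CARD('n) = 2 * m"
    and "symplectic_form \<omega>"
    and "\<And>v w. v \<in> F_minus_vec \<Longrightarrow> w \<in> F_minus_vec \<Longrightarrow> \<omega> v w \<in> F_minus"
    and "arithmetic_subgroup \<omega> \<Gamma>"
  shows "automorphism_rigid (heisenberg \<omega>) heisenberg_topology \<Gamma>"
proof -
  have "of_nat p ^ k = (0 :: 'a)" using of_nat_card_eq_0[where 'a = 'a] assms(3) by simp
  hence "of_nat p = (0 :: 'a)" by simp
  hence char: "of_nat p = (0 :: 'a fls)" by (simp add: of_nat_eq_0_iff_char_dvd)
  interpret odd_symplectic \<omega> p
    by unfold_locales (use assms char in auto)
  show ?thesis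
    unfolding automorphism_rigid_def
    using arithmetic_subgroup_discrete[OF assms(8)] virtual_automorphism_extends[OF assms(8)] by blast
qed

end
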